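(* One can associate to every Coxeter graph $\Gamma$ with finite vertex set $S$, and every subset $T\subset S$, a map $\pi_T=\pi_T^{\Gamma}:\Omega(\Gamma)\to\Omega(\Gamma_T)$ such that: (1) For every subset $T$ of $S$, $\pi_T:\Omega(\Gamma)\to\Omega(\Gamma_T)$ is a retraction of the natural embedding $\Omega(\Gamma_T)\hookrightarrow\Omega(\Gamma)$ (i.e. a continuous map whose restriction to $\Omega(\Gamma_T)$ is the identity), and it is equivariant under the action of $W_T$. (2) For all subsets $R,T$ of $S$, the restriction of $\pi_T:\Omega(\Gamma)\to\Omega(\Gamma_T)$ to $\Omega(\Gamma_R)$ coincides with the retraction $\pi_{R\cap T}=\pi_{R\cap T}^{\Gamma_R}:\Omega(\Gamma_R)\to\Omega(\Gamma_{R\cap T})$ associated with the Coxeter graph $\Gamma_R$ and the subset $R\cap T$ of $R$.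
   Context: A Coxeter matrix over a finite set $S$ is a matrix $(m_{s,t})_{s,t\in S}$ with $m_{s,s}=1$ and $m_{s,t}=m_{t,s}\in\{2,3,\dots,\infty\}$ for $s\ne t$; its Coxeter graph $\Gamma$ has vertex set $S$, with an edge between $s$ and $t$ if $m_{s,t}\ge 3$, labeled by $m_{s,t}$ if $m_{s,t}\ge4$. Its Coxeter group is $W=W_\Gamma=\langle S\mid s^2=1\ (s\in S),\ (st)^{m_{s,t}}=1\ (s\neq t,\ m_{s,t}\ne\infty)\rangle$, and $\lg$ denotes word length on $W$ with respect to $S$. For $X\subset S$, $W_X$ is the subgroup of $W$ generated by $X$ and $\Gamma_X$ is the Coxeter graph of $(m_{s,t})_{s,t\in X}$; $(W_X,X)$ is the Coxeter system of $\Gamma_X$. For $X,Y\subset S$, an element $w\in W$ is $(X,Y)$-reduced if it is of minimal length in $W_XwW_Y$. Let $\mathcal S^f$ be the set of $X\subset S$ such that $W_X$ is finite. Define a partial order on $W\times\mathcal S^f$ by $(u,X)\le(v,Y)$ if $X\subset Y$, $v^{-1}u\in W_Y$, and $v^{-1}u$ is $(\emptyset,X)$-reduced. The complex $\Omega(\Gamma)$ is the geometric realization of the simplicial complex of finite chains of $(W\times\mathcal S^f,\le)$; $W$ acts on it by left multiplication on the first coordinate. For $T\subset S$, set $\mathcal S^f_T=\{X\in\mathcal S^f: X\subset T\}$. The inclusion $W_T\times\mathcal S^f_T\hookrightarrow W\times\mathcal S^f$ induces the natural embedding $\Omega(\Gamma_T)\hookrightarrow\Omega(\Gamma)$, which is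 $W_T$-equivariant, and $\Omega(\Gamma_T)$ is identified with its image. *)

theory Defs
  imports
    "HOL-Analysis.Analysis"
    "HOL-Algebra.Generated_Groups"
    "HOL-Library.Extended_Nat"
begin

section \<open>Groups given by a presentation\<close>

text \<open>A letter \<open>(s, True)\<close> stands for the generator \<open>s\<close>, and \<open>(s, False)\<close> for its
  inverse. The group presented by generators \<open>S\<close> and relators \<open>R\<close> consists of the words modulo
  the congruence generated by free cancellation and by \<open>r \<sim> []\<close> for \<open>r \<in> R\<close>.\<close>

type_synonym 'a gword = "('a \<times> bool) list"

definition gwords :: "'a set \<Rightarrow> 'a gword set" where
  "gwords S = lists (S \<times> UNIV)"

inductive_set presentation_rel :: "'a set \<Rightarrow> 'a gword set \<Rightarrow> ('a gword \<times> 'a gword) set"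
  for S :: "'a set" and R :: "'a gword set" where
  refl: "u \<in> gwords S \<Longrightarrow> (u, u) \<in> presentation_rel S R"
| sym: "(u, v) \<in> presentation_rel S R \<Longrightarrow> (v, u) \<in> presentation_rel S R"
| trans: "(u, v) \<in> presentation_rel S R \<Longrightarrow> (v, w) \<in> presentation_rel S R \<Longrightarrow>
    (u, w) \<in> presentation_rel S R"
| append: "(u, u') \<in> presentation_rel S R \<Longrightarrow> (v, v') \<in> presentation_rel S R \<Longrightarrow>
    (u @ v, u' @ v') \<in> presentation_rel S R"
| cancel: "s \<in> S \<Longrightarrow> ([(s, b), (s, \<not> b)], []) \<in> presentation_rel S R"
| relator: "r \<in> R \<Longrightarrow> r \<in> gwords S \<Longrightarrow> (r, []) \<in> presentation_rel S R"

definition presented_group :: "'a set \<Rightarrow> 'a gword set \<Rightarrow> 'a gword set monoid" where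
  "presented_group S R =
    \<lparr>carrier = gwords S // presentation_rel S R,
     mult = (\<lambda>A B. \<Union>u\<in>A. \<Union>v\<in>B. presentation_rel S R `` {u @ v}),
     one = presentation_rel S R `` {[]}\<rparr>"

lemma presentation_rel_gwords:
  "(u, v) \<in> presentation_rel S R \<Longrightarrow> u \<in> gwords S \<and> v \<in> gwords S"
  by (induction rule: presentation_rel.induct) (auto simp: gwords_def)

lemma equiv_presentation_rel: "equiv (gwords S) (presentation_rel S R)"
proof (rule equivI)
  show "presentation_rel S R \<subseteq> gwords S \<times> gwords S"
    by (auto dest: presentation_rel_gwords)
  show "refl_on (gwords S) (presentation_rel S R)"
    by (auto simp: refl_on_def intro: presentation_rel.refl)
  show "sym (presentation_rel S R)"
    by (rule symI) (rule presentation_rel.sym)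
  show "trans (presentation_rel S R)"
    by (rule transI) (rule presentation_rel.trans)
qed

lemma presented_group_mult_class:
  assumes "u \<in> gwords S" "v \<in> gwords S"
  shows "presentation_rel S R `` {u} \<otimes>\<^bsub>presented_group S R\<^esub> presentation_rel S R `` {v} =
    presentation_rel S R `` {u @ v}" (is "?L = ?R")
proof -
  have "presentation_rel S R `` {u' @ v'} = ?R"
    if "(u, u') \<in> presentation_rel S R" "(v, v') \<in> presentation_rel S R" for u' v'
    using equiv_class_eq[OF equiv_presentation_rel presentation_rel.append[OF that]] by simp
  moreover have "(u, u) \<in> presentation_rel S R" "(v, v) \<in> presentation_rel S R"
    using assms by (auto intro: presentation_rel.refl)
  ultimately have "(\<Union>u'\<in>presentation_rel S R `` {u}. \<Union>v'\<in>presentation_rel S R `` {v}.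
      presentation_rel S R `` {u' @ v'}) = ?R"
    by blast
  then show ?thesis
    by (simp add: presented_group_def)
qed

lemma presented_group_carrierE:
  assumes "A \<in> carrier (presented_group S R)"
  obtains u where "u \<in> gwords S" "A = presentation_rel S R `` {u}"
proof -
  have "A \<in> gwords S // presentation_rel S R"
    using assms by (simp add: presented_group_def)
  then show ?thesis
    using that by (rule quotientE)
qed

lemma presented_group_classI:
  "u \<in> gwords S \<Longrightarrow> presentation_rel S R `` {u} \<in> carrier (presented_group S R)"
  by (simp add: presented_group_def quotientI)

lemma presentation_rel_inverse:
  "u \<in> gwords S \<Longrightarrow> (rev (map (\<lambda>(s, b). (s, \<not> b)) u) @ u, []) \<in> presentation_rel S R"
proof (induction u)
  case Nil
  then show ?case by (auto intro: presentation_rel.refl)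
next
  case (Cons a u)
  obtain s b where a: "a = (s, b)" by (cases a)
  let ?v = "rev (map (\<lambda>(s, b). (s, \<not> b)) u)"
  have s: "s \<in> S" and u: "u \<in> gwords S" using Cons.prems a by (auto simp: gwords_def)
  have v: "?v \<in> gwords S" using u by (auto simp: gwords_def)
  have "([(s, \<not> b), (s, b)], []) \<in> presentation_rel S R"
    using presentation_rel.cancel[OF s, of "\<not> b" R] by simp
  then have "([(s, \<not> b), (s, b)] @ u, [] @ u) \<in> presentation_rel S R"
    using presentation_rel.refl[OF u] by (rule presentation_rel.append)
  with presentation_rel.refl[OF v]
  have "(?v @ [(s, \<not> b), (s, b)] @ u, ?v @ [] @ u) \<in> presentation_rel S R"
    by (rule presentation_rel.append)
  then have "(?v @ [(s, \<not> b), (s, b)] @ u, ?v @ u) \<in> presentation_rel S R"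
    by simp
  from presentation_rel.trans[OF this Cons.IH[OF u]]
  have "(?v @ [(s, \<not> b), (s, b)] @ u, []) \<in> presentation_rel S R" .
  then show ?case by (simp add: a)
qed

lemma group_presented_group: "group (presented_group S R)"
proof (rule groupI)
  fix A assume "A \<in> carrier (presented_group S R)"
  then obtain u where u: "u \<in> gwords S" "A = presentation_rel S R `` {u}"
    by (rule presented_group_carrierE)
  have one: "\<one>\<^bsub>presented_group S R\<^esub> = presentation_rel S R `` {[]}"
    by (simp add: presented_group_def)
  have nil: "[] \<in> gwords S" by (simp add: gwords_def)
  show "\<one>\<^bsub>presented_group S R\<^esub> \<otimes>\<^bsub>presented_group S R\<^esub> A = A"
    using presented_group_mult_class[OF nil u(1), of R] by (simp add: one u(2))
  let ?v = "rev (map (\<lambda>(s, b). (s, \<not> b)) u)"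
  have v: "?v \<in> gwords S" using u by (auto simp: gwords_def)
  have "presentation_rel S R `` {?v} \<otimes>\<^bsub>presented_group S R\<^esub> A = \<one>\<^bsub>presented_group S R\<^esub>"
    using presented_group_mult_class[OF v u(1), of R]
      equiv_class_eq[OF equiv_presentation_rel presentation_rel_inverse[OF u(1)], of R]
    by (simp add: one u(2))
  then show "\<exists>B\<in>carrier (presented_group S R).
      B \<otimes>\<^bsub>presented_group S R\<^esub> A = \<one>\<^bsub>presented_group S R\<^esub>"
    using presented_group_classI[OF v] by blast
next
  show "\<one>\<^bsub>presented_group S R\<^esub> \<in> carrier (presented_group S R)"
    by (simp add: presented_group_def gwords_def quotientI)
next
  fix A B assume "A \<in> carrier (presented_group S R)" "B \<in> carrier (presented_group S R)"
  then obtain u v where u: "u \<in> gwords S" "A = presentation_rel S R `` {u}"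
    and v: "v \<in> gwords S" "B = presentation_rel S R `` {v}"
    by (meson presented_group_carrierE)
  have uv: "u @ v \<in> gwords S" using u(1) v(1) by (simp add: gwords_def)
  show AB: "A \<otimes>\<^bsub>presented_group S R\<^esub> B \<in> carrier (presented_group S R)"
    unfolding u(2) v(2) presented_group_mult_class[OF u(1) v(1)]
    by (rule presented_group_classI[OF uv])
  fix C assume "C \<in> carrier (presented_group S R)"
  then obtain w where w: "w \<in> gwords S" "C = presentation_rel S R `` {w}"
    by (rule presented_group_carrierE)
  have vw: "v @ w \<in> gwords S" using v(1) w(1) by (simp add: gwords_def)
  show "A \<otimes>\<^bsub>presented_group S R\<^esub> B \<otimes>\<^bsub>presented_group S R\<^esub> C =
      A \<otimes>\<^bsub>presented_group S R\<^esub> (B \<otimes>\<^bsub>presented_group S R\<^esub> C)"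
    unfolding u(2) v(2) w(2) presented_group_mult_class[OF u(1) v(1)]
      presented_group_mult_class[OF v(1) w(1)] presented_group_mult_class[OF uv w(1)]
      presented_group_mult_class[OF u(1) vw] append_assoc ..
qed


section \<open>Coxeter graphs and Coxeter groups\<close>

text \<open>A Coxeter graph is recorded as its vertex set and its Coxeter matrix, where
  \<open>\<infinity>\<close> is allowed; \<open>s\<close> and \<open>t\<close> are joined by an edge iff \<open>mat \<Gamma> s t \<ge> 3\<close>. The matrix is
  required to be \<open>0\<close> (not a legal entry) outside the vertex set, so that equality of records is
  equality of Coxeter graphs: whatever is attached to \<open>\<Gamma>\<close> depends on nothing else.\<close>

record 'a coxeter_graph =
  verts :: "'a set"
  mat :: "'a \<Rightarrow> 'a \<Rightarrow> enat"

definition coxeter_graph :: "'a coxeter_graph \<Rightarrow> bool" where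
  "coxeter_graph \<Gamma> \<longleftrightarrow>
    finite (verts \<Gamma>) \<and>
    (\<forall>s\<in>verts \<Gamma>. mat \<Gamma> s s = 1) \<and>
    (\<forall>s\<in>verts \<Gamma>. \<forall>t\<in>verts \<Gamma>. s \<noteq> t \<longrightarrow> mat \<Gamma> s t = mat \<Gamma> t s \<and> mat \<Gamma> s t \<ge> 2) \<and>
    (\<forall>s t. s \<notin> verts \<Gamma> \<or> t \<notin> verts \<Gamma> \<longrightarrow> mat \<Gamma> s t = 0)"

definition sub_coxeter_graph :: "'a coxeter_graph \<Rightarrow> 'a set \<Rightarrow> 'a coxeter_graph"
  (infixl "\<restriction>\<^sub>C" 90) where
  "\<Gamma> \<restriction>\<^sub>C X = \<lparr>verts = X, mat = (\<lambda>s t. if s \<in> X \<and> t \<in> X then mat \<Gamma> s t else 0)\<rparr>"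

definition coxeter_relators :: "'a coxeter_graph \<Rightarrow> 'a gword set" where
  "coxeter_relators \<Gamma> =
    {[(s, True), (s, True)] | s. s \<in> verts \<Gamma>} \<union>
    {concat (replicate n [(s, True), (t, True)]) | s t n.
      s \<in> verts \<Gamma> \<and> t \<in> verts \<Gamma> \<and> s \<noteq> t \<and> mat \<Gamma> s t = enat n}"

definition cox_group :: "'a coxeter_graph \<Rightarrow> 'a gword set monoid" where
  "cox_group \<Gamma> = presented_group (verts \<Gamma>) (coxeter_relators \<Gamma>)"

definition cox_rel :: "'a coxeter_graph \<Rightarrow> ('a gword \<times> 'a gword) set" where
  "cox_rel \<Gamma> = presentation_rel (verts \<Gamma>) (coxeter_relators \<Gamma>)"

definition cox_gen :: "'a coxeter_graph \<Rightarrow> 'a \<Rightarrow> 'a gword set" where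
  "cox_gen \<Gamma> s = cox_rel \<Gamma> `` {[(s, True)]}"

definition cox_length :: "'a coxeter_graph \<Rightarrow> 'a gword set \<Rightarrow> nat" where
  "cox_length \<Gamma> w = (LEAST n. \<exists>ss. length ss = n \<and> set ss \<subseteq> verts \<Gamma> \<and>
    foldr (\<lambda>s g. cox_gen \<Gamma> s \<otimes>\<^bsub>cox_group \<Gamma>\<^esub> g) ss \<one>\<^bsub>cox_group \<Gamma>\<^esub> = w)"

text \<open>\<open>cox_parabolic \<Gamma> X\<close> is the subgroup \<open>W\<^sub>X\<close> of \<open>W\<close>, as opposed to the
  Coxeter group \<open>cox_group (\<Gamma> \<restriction>\<^sub>C X)\<close> defined by its own presentation.\<close>

definition cox_parabolic :: "'a coxeter_graph \<Rightarrow> 'a set \<Rightarrow> 'a gword set set" where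
  "cox_parabolic \<Gamma> X = generate (cox_group \<Gamma>) (cox_gen \<Gamma> ` X)"

text \<open>For \<open>T \<subseteq> verts \<Gamma>\<close>, the homomorphism from the Coxeter group of \<open>\<Gamma> \<restriction>\<^sub>C T\<close> to that of \<open>\<Gamma>\<close>
  sending each generator to the generator of the same name: the class of a word is sent to the
  class of the same word for the larger congruence.\<close>

definition cox_incl :: "'a coxeter_graph \<Rightarrow> 'a gword set \<Rightarrow> 'a gword set" where
  "cox_incl \<Gamma> A = cox_rel \<Gamma> `` A"

definition cox_reduced ::
  "'a coxeter_graph \<Rightarrow> 'a set \<Rightarrow> 'a set \<Rightarrow> 'a gword set \<Rightarrow> bool" where
  "cox_reduced \<Gamma> X Y w \<longleftrightarrow> w \<in> carrier (cox_group \<Gamma>) \<and>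
    (\<forall>w' \<in> (cox_parabolic \<Gamma> X #>\<^bsub>cox_group \<Gamma>\<^esub> w) <#>\<^bsub>cox_group \<Gamma>\<^esub> cox_parabolic \<Gamma> Y.
      cox_length \<Gamma> w \<le> cox_length \<Gamma> w')"


section \<open>Geometric realization of an abstract simplicial complex\<close>

text \<open>A complex is given by its set of (nonempty, finite) simplices; points of the realization
  are given by their barycentric coordinates. The topology is the weak one: a set is open iff
  its trace on each closed simplex is open there.\<close>

definition order_complex :: "('v \<times> 'v) set \<Rightarrow> 'v set set" where
  "order_complex r = {C \<in> Chains r. finite C \<and> C \<noteq> {}}"

definition realization_points :: "'v set set \<Rightarrow> ('v \<Rightarrow> real) set" where
  "realization_points K =
    {\<alpha>. (\<forall>v. \<alpha> v \<ge> 0) \<and> {v. \<alpha> v \<noteq> 0} \<in> K \<and> (\<Sum>v | \<alpha> v \<noteq> 0. \<alpha> v) = 1}"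

definition closed_simplex :: "'v set \<Rightarrow> ('v \<Rightarrow> real) set" where
  "closed_simplex \<sigma> =
    {\<alpha>. (\<forall>v. \<alpha> v \<ge> 0) \<and> {v. \<alpha> v \<noteq> 0} \<subseteq> \<sigma> \<and> (\<Sum>v\<in>\<sigma>. \<alpha> v) = 1}"

definition geometric_realization :: "'v set set \<Rightarrow> ('v \<Rightarrow> real) topology" where
  "geometric_realization K = topology (\<lambda>U. U \<subseteq> realization_points K \<and>
    (\<forall>\<sigma>\<in>K. openin (top_of_set (closed_simplex \<sigma>)) (U \<inter> closed_simplex \<sigma>)))"

lemma openin_geometric_realization:
  "openin (geometric_realization K) U \<longleftrightarrow> U \<subseteq> realization_points K \<and>
    (\<forall>\<sigma>\<in>K. openin (top_of_set (closed_simplex \<sigma>)) (U \<inter> closed_simplex \<sigma>))"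
proof -
  have "istopology (\<lambda>U. U \<subseteq> realization_points K \<and>
      (\<forall>\<sigma>\<in>K. openin (top_of_set (closed_simplex \<sigma>)) (U \<inter> closed_simplex \<sigma>)))"
    unfolding istopology_def
  proof (intro conjI allI impI ballI)
    fix U V \<sigma>
    assume U: "U \<subseteq> realization_points K \<and>
        (\<forall>\<sigma>\<in>K. openin (top_of_set (closed_simplex \<sigma>)) (U \<inter> closed_simplex \<sigma>))"
      and V: "V \<subseteq> realization_points K \<and>
        (\<forall>\<sigma>\<in>K. openin (top_of_set (closed_simplex \<sigma>)) (V \<inter> closed_simplex \<sigma>))"
    from U show "U \<inter> V \<subseteq> realization_points K" by blast
    assume "\<sigma> \<in> K"
    with U V have "openin (top_of_set (closed_simplex \<sigma>)) (U \<inter> closed_simplex \<sigma>)"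
      and "openin (top_of_set (closed_simplex \<sigma>)) (V \<inter> closed_simplex \<sigma>)" by blast+
    then have "openin (top_of_set (closed_simplex \<sigma>))
        ((U \<inter> closed_simplex \<sigma>) \<inter> (V \<inter> closed_simplex \<sigma>))"
      by (rule openin_Int)
    moreover have "(U \<inter> closed_simplex \<sigma>) \<inter> (V \<inter> closed_simplex \<sigma>) = U \<inter> V \<inter> closed_simplex \<sigma>"
      by blast
    ultimately show "openin (top_of_set (closed_simplex \<sigma>)) (U \<inter> V \<inter> closed_simplex \<sigma>)"
      by simp
  next
    fix \<U> \<sigma>
    assume \<U>: "\<forall>U\<in>\<U>. U \<subseteq> realization_points K \<and>
        (\<forall>\<sigma>\<in>K. openin (top_of_set (closed_simplex \<sigma>)) (U \<inter> closed_simplex \<sigma>))"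
    then show "\<Union>\<U> \<subseteq> realization_points K" by blast
    assume "\<sigma> \<in> K"
    with \<U> have "openin (top_of_set (closed_simplex \<sigma>)) W"
      if "W \<in> (\<lambda>U. U \<inter> closed_simplex \<sigma>) ` \<U>" for W
      using that by blast
    then have "openin (top_of_set (closed_simplex \<sigma>)) (\<Union>((\<lambda>U. U \<inter> closed_simplex \<sigma>) ` \<U>))"
      by (rule openin_Union)
    moreover have "\<Union>((\<lambda>U. U \<inter> closed_simplex \<sigma>) ` \<U>) = \<Union>\<U> \<inter> closed_simplex \<sigma>"
      by blast
    ultimately show "openin (top_of_set (closed_simplex \<sigma>)) (\<Union>\<U> \<inter> closed_simplex \<sigma>)"
      by simp
  qed
  then show ?thesis
    unfolding geometric_realization_def by (simp add: topology_inverse')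
qed

text \<open>The affine extension of a simplicial map \<open>f\<close> given on vertices.\<close>

definition realization_map :: "('v \<Rightarrow> 'w) \<Rightarrow> ('v \<Rightarrow> real) \<Rightarrow> 'w \<Rightarrow> real" where
  "realization_map f \<alpha> = (\<lambda>y. \<Sum>x | \<alpha> x \<noteq> 0 \<and> f x = y. \<alpha> x)"


section \<open>The complex \<open>\<Omega>\<close>\<close>

type_synonym 'a omega_vertex = "'a gword set \<times> 'a set"
type_synonym 'a omega_point = "'a omega_vertex \<Rightarrow> real"

definition spherical_subsets :: "'a coxeter_graph \<Rightarrow> 'a set set" where
  "spherical_subsets \<Gamma> = {X. X \<subseteq> verts \<Gamma> \<and> finite (cox_parabolic \<Gamma> X)}"

definition omega_vertices :: "'a coxeter_graph \<Rightarrow> 'a omega_vertex set" where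
  "omega_vertices \<Gamma> = carrier (cox_group \<Gamma>) \<times> spherical_subsets \<Gamma>"

definition omega_order :: "'a coxeter_graph \<Rightarrow> ('a omega_vertex \<times> 'a omega_vertex) set" where
  "omega_order \<Gamma> = {((u, X), (v, Y)).
    (u, X) \<in> omega_vertices \<Gamma> \<and> (v, Y) \<in> omega_vertices \<Gamma> \<and> X \<subseteq> Y \<and>
    inv\<^bsub>cox_group \<Gamma>\<^esub> v \<otimes>\<^bsub>cox_group \<Gamma>\<^esub> u \<in> cox_parabolic \<Gamma> Y \<and>
    cox_reduced \<Gamma> {} X (inv\<^bsub>cox_group \<Gamma>\<^esub> v \<otimes>\<^bsub>cox_group \<Gamma>\<^esub> u)}"

definition omega :: "'a coxeter_graph \<Rightarrow> 'a omega_point topology" where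
  "omega \<Gamma> = geometric_realization (order_complex (omega_order \<Gamma>))"

definition omega_act ::
  "'a coxeter_graph \<Rightarrow> 'a gword set \<Rightarrow> 'a omega_point \<Rightarrow> 'a omega_point" where
  "omega_act \<Gamma> w = realization_map (\<lambda>(u, X). (w \<otimes>\<^bsub>cox_group \<Gamma>\<^esub> u, X))"

text \<open>The natural embedding of \<open>omega (\<Gamma> \<restriction>\<^sub>C T)\<close> into \<open>omega \<Gamma>\<close>, for \<open>T \<subseteq> verts \<Gamma>\<close>.\<close>

definition omega_incl :: "'a coxeter_graph \<Rightarrow> 'a omega_point \<Rightarrow> 'a omega_point" where
  "omega_incl \<Gamma> = realization_map (\<lambda>(u, X). (cox_incl \<Gamma> u, X))"

end

(*
Write u in W as u = u0 u1 with u0 in W_T and u1 of minimal length in W_T u. The map pi_T is the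
simplicial map induced by (u, X) |-> (u0, {t in T. t in u1 W_X u1^-1}); the point is that it is
order preserving. For that, let N(w) be the set of reflections r with lg(r w) < lg(w). It satisfies
N(u v) = N(u) + u N(v) u^-1 (symmetric difference), and u1 is minimal in W_T u1 iff N(u1) does not
meet W_T. If (u, X) <= (v, Y), u = v w and a = v0^-1 u0, then v1 w = a u1, and comparing the parts of
N(v1 w) = N(a u1) inside W_T shows that every letter of a lies in the conjugate of W_Y by v1 and that
a is reduced with respect to the image of X.

Both the cocycle N and the injectivity of W_T -> W have to be established from the presentation.
N comes from counting modulo 2 the reflections met along a word. Injectivity follows from
faithfulness of the geometric representation, which for W_T is a subrepresentation of the one for W.
*)
theory Submission
  imports Defs
begin

section \<open>Coxeter groups and words\<close>

text \<open>The group W_T occurs in two forms: as a subgroup of W, where cosets and conjugates are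
  formed, and as a group with its own presentation, over which Omega(Gamma_T) is built. The two
  carry different length functions, and nothing is known beforehand that compares them. The sets
  N(w) do compare: once \<open>cox_incl\<close> is injective, N for W_T is the trace of N for W.
  Minimality in cosets is therefore expressed by N throughout, and
  \<open>left_reduced_exists\<close> and \<open>cox_reduced_iff\<close> are the passages from
  length.

  The second component of the projection looks as if it called for a description of W_T \<inter> u1
  W_X u1^-1 as a parabolic subgroup. This is bypassed: only conjugates of single generators are
  followed, one letter at a time.

  N and the geometric representation have a common source: letters act on a set by involutions, and
  the relators are checked to act trivially. For (2), a factor that is reduced inside W_R has its
  whole set N inside W_R, so it stays reduced in W with respect to T.\<close>

locale coxeter =
  fixes \<Gamma> :: "'a coxeter_graph"
  assumes graph: "coxeter_graph \<Gamma>"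
begin

abbreviation "S \<equiv> verts \<Gamma>"
abbreviation "G \<equiv> cox_group \<Gamma>"
abbreviation "gen \<equiv> cox_gen \<Gamma>"

text \<open>Exponents are dropped: generators are involutions, so by \<open>class_eq_cls\<close>
  every element of the group is the class of a word in plain letters.\<close>

definition cls :: "'a list \<Rightarrow> 'a gword set" where
  "cls ss = cox_rel \<Gamma> `` {map (\<lambda>s. (s, True)) ss}"

sublocale group G
  unfolding cox_group_def by (rule group_presented_group)

lemma finite_S: "finite S"
  using graph by (simp add: coxeter_graph_def)

lemma mat_sym: "s \<in> S \<Longrightarrow> t \<in> S \<Longrightarrow> mat \<Gamma> s t = mat \<Gamma> t s"
  using graph unfolding coxeter_graph_def by metis

lemma mat_ge_2: "s \<in> S \<Longrightarrow> t \<in> S \<Longrightarrow> s \<noteq> t \<Longrightarrow> mat \<Gamma> s t \<ge> 2"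
  using graph unfolding coxeter_graph_def by metis

lemma equiv_cox_rel: "equiv (gwords S) (cox_rel \<Gamma>)"
  unfolding cox_rel_def by (rule equiv_presentation_rel)

lemma word_gwords: "set ss \<subseteq> S \<Longrightarrow> map (\<lambda>s. (s, True)) ss \<in> gwords S"
  by (auto simp: gwords_def)

lemma cls_closed [simp]: "set ss \<subseteq> S \<Longrightarrow> cls ss \<in> carrier G"
  unfolding cls_def cox_group_def cox_rel_def
  by (rule presented_group_classI[OF word_gwords])

lemma cls_append: "set ss \<subseteq> S \<Longrightarrow> set ts \<subseteq> S \<Longrightarrow> cls (ss @ ts) = cls ss \<otimes>\<^bsub>G\<^esub> cls ts"
  using presented_group_mult_class[OF word_gwords word_gwords, of ss ts "coxeter_relators \<Gamma>"]
  by (simp add: cls_def cox_group_def cox_rel_def)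

lemma cls_Nil [simp]: "cls [] = \<one>\<^bsub>G\<^esub>"
  by (simp add: cls_def cox_group_def cox_rel_def presented_group_def)

lemma cls_single: "cls [s] = gen s"
  by (simp add: cls_def cox_gen_def)

lemma gen_closed [simp]: "s \<in> S \<Longrightarrow> gen s \<in> carrier G"
  using cls_closed[of "[s]"] by (simp add: cls_single)

lemma cls_Cons: "s \<in> S \<Longrightarrow> set ss \<subseteq> S \<Longrightarrow> cls (s # ss) = gen s \<otimes>\<^bsub>G\<^esub> cls ss"
  using cls_append[of "[s]" ss] by (simp add: cls_single)

lemma cls_eqI: "(map (\<lambda>s. (s, True)) ss, map (\<lambda>s. (s, True)) ts) \<in> cox_rel \<Gamma> \<Longrightarrow> cls ss = cls ts"
  unfolding cls_def by (rule equiv_class_eq[OF equiv_cox_rel])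

lemma cls_eqD: "set ts \<subseteq> S \<Longrightarrow> cls ss = cls ts \<Longrightarrow>
    (map (\<lambda>s. (s, True)) ss, map (\<lambda>s. (s, True)) ts) \<in> cox_rel \<Gamma>"
  unfolding cls_def by (rule eq_equiv_class[OF _ equiv_cox_rel word_gwords])

lemma square_rel: "s \<in> S \<Longrightarrow> ([(s, True), (s, True)], []) \<in> cox_rel \<Gamma>"
  unfolding cox_rel_def
  by (rule presentation_rel.relator) (auto simp: coxeter_relators_def gwords_def)

lemma gen_sq [simp]: "s \<in> S \<Longrightarrow> gen s \<otimes>\<^bsub>G\<^esub> gen s = \<one>\<^bsub>G\<^esub>"
  using cls_eqI[of "[s,s]" "[]"] square_rel[of s] by (simp add: cls_Cons cls_single)

lemma gen_inv [simp]: "s \<in> S \<Longrightarrow> inv\<^bsub>G\<^esub> gen s = gen s"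
  by (rule inv_equality) simp_all

text \<open>The word s^-1 s s collapses to s^-1 by the relator and to s by free
  cancellation.\<close>

lemma letter_rel:
  assumes "s \<in> S" shows "([(s, b)], [(s, True)]) \<in> cox_rel \<Gamma>"
proof (cases b)
  case True
  then show ?thesis using assms
    by (auto simp: cox_rel_def gwords_def intro!: presentation_rel.refl)
next
  case False
  have "([(s, False)] @ [(s, True), (s, True)], [(s, False)] @ []) \<in> cox_rel \<Gamma>"
    using square_rel[OF assms] assms unfolding cox_rel_def
    by (intro presentation_rel.append presentation_rel.refl) (auto simp: gwords_def)
  moreover have "([(s, False), (s, True)] @ [(s, True)], [] @ [(s, True)]) \<in> cox_rel \<Gamma>"
    using presentation_rel.cancel[of s S False "coxeter_relators \<Gamma>"] assms unfolding cox_rel_def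
    by (intro presentation_rel.append presentation_rel.refl) (auto simp: gwords_def)
  ultimately show ?thesis using False
    unfolding cox_rel_def by simp (metis presentation_rel.sym presentation_rel.trans)
qed

lemma gword_positive_rel:
  "u \<in> gwords S \<Longrightarrow> (u, map (\<lambda>s. (s, True)) (map fst u)) \<in> cox_rel \<Gamma>"
proof (induction u)
  case Nil
  then show ?case by (auto simp: cox_rel_def intro: presentation_rel.refl)
next
  case (Cons a u)
  then have "([(fst a, snd a)] @ u, [(fst a, True)] @ map (\<lambda>s. (s, True)) (map fst u)) \<in> cox_rel \<Gamma>"
    using letter_rel[of "fst a" "snd a"] unfolding cox_rel_def
    by (intro presentation_rel.append) (auto simp: gwords_def)
  then show ?case by simp
qed

lemma class_eq_cls: "u \<in> gwords S \<Longrightarrow> cox_rel \<Gamma> `` {u} = cls (map fst u)"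
  unfolding cls_def by (rule equiv_class_eq[OF equiv_cox_rel gword_positive_rel])

lemma carrierE:
  assumes "w \<in> carrier G" obtains ss where "set ss \<subseteq> S" "w = cls ss"
proof -
  obtain u where "u \<in> gwords S" "w = cox_rel \<Gamma> `` {u}"
    using assms unfolding cox_group_def cox_rel_def by (rule presented_group_carrierE)
  then show ?thesis using that[of "map fst u"] class_eq_cls[of u]
    by (force simp: gwords_def)
qed

lemma cls_rev: "set ss \<subseteq> S \<Longrightarrow> cls (rev ss) = inv\<^bsub>G\<^esub> cls ss"
proof (induction ss)
  case (Cons s ss)
  then show ?case
    using cls_append[of "rev ss" "[s]"] by (simp add: cls_single cls_Cons inv_mult_group)
qed simp

lemma cls_parabolic:
  assumes "set ss \<subseteq> S" "X \<subseteq> S" "set ss \<subseteq> X" shows "cls ss \<in> cox_parabolic \<Gamma> X"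
  using assms(3)
proof (induction ss)
  case Nil
  then show ?case by (simp add: cox_parabolic_def generate.one)
next
  case (Cons s ss)
  then show ?case using assms(2) unfolding cox_parabolic_def
    by (subst cls_Cons) (auto intro: generate.eng generate.incl)
qed

lemma parabolic_iff:
  assumes "X \<subseteq> S"
  shows "w \<in> cox_parabolic \<Gamma> X \<longleftrightarrow> (\<exists>ss. set ss \<subseteq> X \<and> w = cls ss)"
proof
  assume "w \<in> cox_parabolic \<Gamma> X"
  then show "\<exists>ss. set ss \<subseteq> X \<and> w = cls ss"
    unfolding cox_parabolic_def
  proof (induction rule: generate.induct)
    case one
    then show ?case by (intro exI[of _ "[]"]) simp
  next
    case (incl h)
    then obtain s where "s \<in> X" "h = gen s" by auto
    then show ?case by (intro exI[of _ "[s]"]) (simp add: cls_single)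
  next
    case (inv h)
    then obtain s where "s \<in> X" "h = gen s" by auto
    then show ?case using assms by (intro exI[of _ "[s]"]) (auto simp add: cls_single)
  next
    case (eng h1 h2)
    then obtain us vs where uv: "set us \<subseteq> X" "h1 = cls us" "set vs \<subseteq> X" "h2 = cls vs" by auto
    then have "cls (us @ vs) = h1 \<otimes>\<^bsub>G\<^esub> h2" using assms cls_append[of us vs] by simp
    then show ?case using uv by (intro exI[of _ "us @ vs"]) simp
  qed
qed (use assms cls_parabolic in blast)

lemma subgroup_parabolic: "X \<subseteq> S \<Longrightarrow> subgroup (cox_parabolic \<Gamma> X) G"
  unfolding cox_parabolic_def by (rule generate_is_subgroup) auto

lemma parabolic_carrier: "X \<subseteq> S \<Longrightarrow> w \<in> cox_parabolic \<Gamma> X \<Longrightarrow> w \<in> carrier G"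
  by (rule subgroup.mem_carrier[OF subgroup_parabolic])

lemma parabolic_mono: "X \<subseteq> Y \<Longrightarrow> cox_parabolic \<Gamma> X \<subseteq> cox_parabolic \<Gamma> Y"
  unfolding cox_parabolic_def by (rule mono_generate) auto

lemma gen_parabolic: "s \<in> X \<Longrightarrow> gen s \<in> cox_parabolic \<Gamma> X"
  unfolding cox_parabolic_def by (auto intro: generate.incl)

lemma foldr_eq_cls:
  "set ss \<subseteq> S \<Longrightarrow> foldr (\<lambda>s g. gen s \<otimes>\<^bsub>G\<^esub> g) ss \<one>\<^bsub>G\<^esub> = cls ss"
  by (induction ss) (simp_all add: cls_Cons)

lemma cox_length_eq: "cox_length \<Gamma> w = (LEAST n. \<exists>ss. length ss = n \<and> set ss \<subseteq> S \<and> cls ss = w)"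
  unfolding cox_length_def by (simp add: foldr_eq_cls cong: conj_cong)

lemma cox_length_le: "set ss \<subseteq> S \<Longrightarrow> cox_length \<Gamma> (cls ss) \<le> length ss"
  unfolding cox_length_eq by (rule Least_le) auto

lemma reduced_wordE:
  assumes "w \<in> carrier G"
  obtains ss where "set ss \<subseteq> S" "w = cls ss" "length ss = cox_length \<Gamma> w"
proof -
  obtain ts where "set ts \<subseteq> S" "w = cls ts" using assms by (rule carrierE)
  then have "\<exists>n ss. length ss = n \<and> set ss \<subseteq> S \<and> cls ss = w" by auto
  then have "\<exists>ss. length ss = cox_length \<Gamma> w \<and> set ss \<subseteq> S \<and> cls ss = w"
    unfolding cox_length_eq by (rule LeastI_ex)
  then show ?thesis using that by auto
qed

lemma gen_mult_pow:
  assumes "s \<in> S" "t \<in> S" "s \<noteq> t" "mat \<Gamma> s t = enat m"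
  shows "cls (concat (replicate m [s, t])) = \<one>\<^bsub>G\<^esub>"
proof -
  have "map (\<lambda>s. (s, True)) (concat (replicate m [s, t])) =
      concat (replicate m [(s, True), (t, True)])" for m
    by (induction m) auto
  moreover have "concat (replicate m [(s, True), (t, True)]) \<in> coxeter_relators \<Gamma>"
    using assms by (auto simp: coxeter_relators_def)
  moreover have "concat (replicate m [(s, True), (t, True)]) \<in> gwords S" for m
    using assms by (induction m) (auto simp: gwords_def)
  ultimately have "(map (\<lambda>s. (s, True)) (concat (replicate m [s, t])), map (\<lambda>s. (s, True)) []) \<in> cox_rel \<Gamma>"
    unfolding cox_rel_def by (auto intro: presentation_rel.relator)
  then show ?thesis using cls_eqI by fastforce
qed

lemma cls_concat_replicate:
  assumes "s \<in> S" "t \<in> S"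
  shows "cls (concat (replicate m [s, t])) = (gen s \<otimes>\<^bsub>G\<^esub> gen t) [^]\<^bsub>G\<^esub> m"
proof (induction m)
  case (Suc m)
  have *: "set (concat (replicate m [s, t])) \<subseteq> S" using assms by (induction m) auto
  have "cls (concat (replicate (Suc m) [s, t])) = (gen s \<otimes>\<^bsub>G\<^esub> gen t) \<otimes>\<^bsub>G\<^esub> (gen s \<otimes>\<^bsub>G\<^esub> gen t) [^]\<^bsub>G\<^esub> m"
    using cls_append[of "[s,t]" "concat (replicate m [s, t])"] Suc assms *
    by (simp add: cls_Cons cls_single)
  then show ?case using assms nat_pow_Suc2[of "gen s \<otimes>\<^bsub>G\<^esub> gen t" m] by simp
qed simp

section \<open>Functions on W defined letter by letter\<close>

lemma foldr_respects_cox_rel: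
  assumes closed: "\<And>s x. s \<in> S \<Longrightarrow> x \<in> D \<Longrightarrow> f s x \<in> D"
    and square: "\<And>s x. s \<in> S \<Longrightarrow> x \<in> D \<Longrightarrow> f s (f s x) = x"
    and braid: "\<And>s t m x. s \<in> S \<Longrightarrow> t \<in> S \<Longrightarrow> s \<noteq> t \<Longrightarrow> mat \<Gamma> s t = enat m \<Longrightarrow> x \<in> D \<Longrightarrow>
      ((f s \<circ> f t) ^^ m) x = x"
    and uv: "(u, v) \<in> cox_rel \<Gamma>" and x: "x \<in> D"
  shows "foldr f (map fst u) x = foldr f (map fst v) x"
proof -
  have D: "foldr f ss x \<in> D" if "set ss \<subseteq> S" "x \<in> D" for ss x
    using that by (induction ss) (auto intro: closed)
  have word: "set (map fst u) \<subseteq> S" if "(u, v) \<in> presentation_rel S R" for u v R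
    using presentation_rel_gwords[OF that] by (auto simp: gwords_def)
  show ?thesis using uv x unfolding cox_rel_def
  proof (induction arbitrary: x rule: presentation_rel.induct)
    case (append u u' v v')
    then show ?case using D[OF word[OF append.hyps(2)]] by auto
  next
    case (sym u v)
    then show ?case by metis
  next
    case (trans u v w)
    then show ?case by metis
  next
    case (relator r)
    then consider s where "s \<in> S" "r = [(s, True), (s, True)]"
      | s t n where "s \<in> S" "t \<in> S" "s \<noteq> t" "mat \<Gamma> s t = enat n"
          "r = concat (replicate n [(s, True), (t, True)])"
      unfolding coxeter_relators_def by auto
    then show ?case
    proof cases
      case 1
      then show ?thesis using relator.prems square by simp
    next
      case 2
      have "foldr f (map fst (concat (replicate k [(s, True), (t, True)]))) = (f s \<circ> f t) ^^ k" for k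
        by (induction k) (auto simp: comp_assoc)
      then show ?thesis using braid[OF 2(1-4) relator.prems] 2(5) by simp
    qed
  qed (simp_all add: square)
qed

text \<open>The universal property of the presentation in the form used below: once with
  \<open>par_step\<close> on \<open>carrier G \<times> UNIV\<close>, once with
  \<open>reflect\<close> on all coordinate vectors. The domain \<open>D\<close> is there because the
  identities for \<open>par_step\<close> hold only for group elements.\<close>

lemma foldr_cong_cls:
  assumes "\<And>s x. s \<in> S \<Longrightarrow> x \<in> D \<Longrightarrow> f s x \<in> D"
    and "\<And>s x. s \<in> S \<Longrightarrow> x \<in> D \<Longrightarrow> f s (f s x) = x"
    and "\<And>s t m x. s \<in> S \<Longrightarrow> t \<in> S \<Longrightarrow> s \<noteq> t \<Longrightarrow> mat \<Gamma> s t = enat m \<Longrightarrow> x \<in> D \<Longrightarrow>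
      ((f s \<circ> f t) ^^ m) x = x"
    and "set ts \<subseteq> S" "cls ss = cls ts" "x \<in> D"
  shows "foldr f ss x = foldr f ts x"
proof -
  have 1: "(map (\<lambda>s. (s, True)) ss, map (\<lambda>s. (s, True)) ts) \<in> cox_rel \<Gamma>"
    using assms(4,5) by (rule cls_eqD)
  have "foldr f (map fst (map (\<lambda>s. (s, True)) ss)) x = foldr f (map fst (map (\<lambda>s. (s, True)) ts)) x"
    by (rule foldr_respects_cox_rel[where D = D]) (fact assms 1)+
  then show ?thesis by (simp add: comp_def)
qed

end


section \<open>The reflection cocycle\<close>

context coxeter begin

abbreviation mul (infixl "\<cdot>" 70) where "x \<cdot> y \<equiv> x \<otimes>\<^bsub>G\<^esub> y"
abbreviation unit ("\<e>") where "\<e> \<equiv> \<one>\<^bsub>G\<^esub>"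
abbreviation inver ("\<iota>") where "\<iota> x \<equiv> inv\<^bsub>G\<^esub> x"

lemma inv_cancel [simp]:
  assumes "x \<in> carrier G" "y \<in> carrier G"
  shows "\<iota> x \<cdot> (x \<cdot> y) = y" "x \<cdot> (\<iota> x \<cdot> y) = y"
  using assms by (simp_all flip: m_assoc)

lemma gen_cancel [simp]: "s \<in> S \<Longrightarrow> y \<in> carrier G \<Longrightarrow> gen s \<cdot> (gen s \<cdot> y) = y"
  by (simp flip: m_assoc)

lemma conj_eq_iff:
  assumes "x \<in> carrier G" "r \<in> carrier G" "q \<in> carrier G"
  shows "\<iota> x \<cdot> r \<cdot> x = q \<longleftrightarrow> r = x \<cdot> q \<cdot> \<iota> x"
  using assms by (auto simp: m_assoc)

text \<open>For a word s_1 ... s_k this is the parity of the number of i with r = (s_1 ... s_(i-1))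
  s_i (s_1 ... s_(i-1))^-1. Rather than conjugating the letter by the prefix, the recursion
  conjugates \<open>r\<close> back. Inequality of booleans serves as addition modulo 2.\<close>

primrec par :: "'a list \<Rightarrow> 'a gword set \<Rightarrow> bool" where
  "par [] r = False"
| "par (s # ss) r = ((r = gen s) \<noteq> par ss (gen s \<cdot> r \<cdot> gen s))"

text \<open>The classical action of a generator on reflections with signs, here on all group
  elements with a boolean as sign.\<close>

definition par_step :: "'a \<Rightarrow> 'a gword set \<times> bool \<Rightarrow> 'a gword set \<times> bool" where
  "par_step s = (\<lambda>(r, e). (gen s \<cdot> r \<cdot> gen s, e \<noteq> (r = gen s)))"

lemma fold_par_step:
  "set ss \<subseteq> S \<Longrightarrow> r \<in> carrier G \<Longrightarrow>
    fold par_step ss (r, e) = (\<iota> (cls ss) \<cdot> r \<cdot> cls ss, e \<noteq> par ss r)"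
  by (induction ss arbitrary: r e)
    (auto simp: par_step_def cls_Cons inv_mult_group m_assoc)

text \<open>The word being read is t s t s ... of length 2 k. The reflections met along it are t, t
  s t, t s t s t, ..., that is, c^i t for i < 2 k.\<close>

lemma par_step_pow:
  assumes "s \<in> S" "t \<in> S" "r \<in> carrier G"
  defines "c \<equiv> gen t \<cdot> gen s"
  shows "((par_step s \<circ> par_step t) ^^ k) (r, e) =
    (\<iota> (c [^]\<^bsub>G\<^esub> k) \<cdot> r \<cdot> c [^]\<^bsub>G\<^esub> k,
     e \<noteq> odd (\<Sum>i<2 * k. of_bool (r = c [^]\<^bsub>G\<^esub> i \<cdot> gen t) :: nat))"
  using assms(3)
proof (induction k arbitrary: r e)
  case 0
  then show ?case by simp
next
  case (Suc k)
  have c: "c \<in> carrier G" "gen s \<in> carrier G" "gen t \<in> carrier G" using assms by auto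
  have ic: "\<iota> c = gen s \<cdot> gen t" using assms by (simp add: c_def inv_mult_group)
  have step: "par_step s (par_step t (r, e)) =
      (\<iota> c \<cdot> r \<cdot> c, e \<noteq> ((r = gen t) \<noteq> (r = c \<cdot> gen t)))"
  proof -
    have "gen t \<cdot> r \<cdot> gen t = gen s \<longleftrightarrow> r = c \<cdot> gen t"
      using conj_eq_iff[of "gen t" r "gen s"] assms(1,2) Suc.prems by (simp add: c_def)
    then show ?thesis using assms(1,2) Suc.prems
      by (auto simp add: par_step_def ic) (simp_all add: c_def m_assoc)
  qed
  \<comment> \<open>Since t inverts c, conjugating c^i t by c gives c^(i+2) t. One round of two
    letters thus shifts the list of reflections by two places.\<close>
  have shift: "\<iota> c \<cdot> r \<cdot> c = c [^]\<^bsub>G\<^esub> i \<cdot> gen t \<longleftrightarrow> r = c [^]\<^bsub>G\<^esub> (Suc (Suc i)) \<cdot> gen t" for i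
  proof -
    have "c \<cdot> (c [^]\<^bsub>G\<^esub> i \<cdot> gen t) \<cdot> \<iota> c = (c \<cdot> c [^]\<^bsub>G\<^esub> i) \<cdot> c \<cdot> gen t"
      using c assms(1,2) by (simp add: ic m_assoc) (simp add: c_def m_assoc)
    then show ?thesis
      using c Suc.prems nat_pow_Suc2[of c i] by (subst conj_eq_iff) simp_all
  qed
  have par: "odd (\<Sum>i<2 * Suc k. of_bool (r = c [^]\<^bsub>G\<^esub> i \<cdot> gen t) :: nat) =
      (((r = gen t) \<noteq> (r = c \<cdot> gen t)) \<noteq>
       odd (\<Sum>i<2 * k. of_bool (\<iota> c \<cdot> r \<cdot> c = c [^]\<^bsub>G\<^esub> i \<cdot> gen t) :: nat))"
    unfolding shift using c
    by (simp add: sum.lessThan_Suc_shift del: sum.lessThan_Suc)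
  have "((par_step s \<circ> par_step t) ^^ Suc k) (r, e) =
      ((par_step s \<circ> par_step t) ^^ k) (\<iota> c \<cdot> r \<cdot> c, e \<noteq> ((r = gen t) \<noteq> (r = c \<cdot> gen t)))"
    by (simp add: funpow_Suc_right step del: funpow.simps)
  also have "\<dots> = (\<iota> (c [^]\<^bsub>G\<^esub> Suc k) \<cdot> r \<cdot> c [^]\<^bsub>G\<^esub> Suc k,
      e \<noteq> odd (\<Sum>i<2 * Suc k. of_bool (r = c [^]\<^bsub>G\<^esub> i \<cdot> gen t) :: nat))"
  proof -
    have "\<iota> (c [^]\<^bsub>G\<^esub> k) \<cdot> (\<iota> c \<cdot> r \<cdot> c) \<cdot> c [^]\<^bsub>G\<^esub> k = \<iota> (c [^]\<^bsub>G\<^esub> Suc k) \<cdot> r \<cdot> c [^]\<^bsub>G\<^esub> Suc k"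
      unfolding nat_pow_Suc2[OF c(1)] using c Suc.prems by (simp add: inv_mult_group m_assoc)
    then show ?thesis
      using c Suc.prems by (subst Suc.IH) (simp, simp only: par, blast)
  qed
  finally show ?case .
qed

lemma sum_periodic:
  fixes f :: "nat \<Rightarrow> nat"
  assumes "\<And>i. f (i + m) = f i" shows "(\<Sum>i<2 * m. f i) = 2 * (\<Sum>i<m. f i)"
proof -
  have "(\<Sum>i<m + k. f i) = (\<Sum>i<m. f i) + (\<Sum>i<k. f i)" for k
    by (induction k) (simp_all add: assms add.commute)
  from this[of m] show ?thesis by (simp add: mult_2)
qed

lemma par_step_involution:
  assumes "s \<in> S" "x \<in> carrier G \<times> UNIV" shows "par_step s (par_step s x) = x"
proof -
  obtain r e where x: "x = (r, e)" "r \<in> carrier G" using assms by auto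
  have "gen s \<cdot> r \<cdot> gen s = gen s \<longleftrightarrow> r = gen s"
    using conj_eq_iff[of "gen s" r "gen s"] assms(1) x by (simp add: m_assoc)
  then show ?thesis using assms(1) x by (simp add: par_step_def m_assoc) blast
qed

text \<open>Going around the relator \<open>(s t)\<^sup>m\<close>, each reflection met in the first half is met again in
  the second half, whatever the order of \<open>s t\<close> in the group is.\<close>

lemma par_step_braid:
  assumes "s \<in> S" "t \<in> S" "s \<noteq> t" "mat \<Gamma> s t = enat m" "x \<in> carrier G \<times> UNIV"
  shows "((par_step s \<circ> par_step t) ^^ m) x = x"
proof -
  obtain r e where x: "x = (r, e)" "r \<in> carrier G" using assms by auto
  let ?c = "gen t \<cdot> gen s"
  have c: "?c [^]\<^bsub>G\<^esub> m = \<e>"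
    using gen_mult_pow[of t s m] cls_concat_replicate[of t s m] assms by (simp add: mat_sym)
  have "?c [^]\<^bsub>G\<^esub> (i + m) = ?c [^]\<^bsub>G\<^esub> i" for i
    using assms c by (simp flip: nat_pow_mult)
  then have "(\<Sum>i<2 * m. of_bool (r = ?c [^]\<^bsub>G\<^esub> i \<cdot> gen t) :: nat) =
      2 * (\<Sum>i<m. of_bool (r = ?c [^]\<^bsub>G\<^esub> i \<cdot> gen t))"
    by (intro sum_periodic) simp
  then show ?thesis
    using par_step_pow[OF assms(1,2) x(2), of m e] x(2) by (simp add: x c)
qed

lemma par_cong:
  assumes "set ss \<subseteq> S" "set ts \<subseteq> S" "cls ss = cls ts" "r \<in> carrier G"
  shows "par ss r = par ts r"
proof -
  \<comment> \<open>\<open>par\<close> reads a word from the left, while \<open>foldr\<close>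
    applies the last letter first; hence the reversal.\<close>
  have "foldr par_step (rev ss) (r, False) = foldr par_step (rev ts) (r, False)"
  proof (rule foldr_cong_cls[where D = "carrier G \<times> UNIV"])
    show "cls (rev ss) = cls (rev ts)" using assms by (simp add: cls_rev)
  qed (use assms par_step_braid par_step_involution in \<open>auto simp: par_step_def\<close>)
  then show ?thesis using assms by (simp add: foldr_conv_fold fold_par_step)
qed

text \<open>The reflections whose walls separate \<open>1\<close> from \<open>w\<close>.\<close>

definition refls :: "'a gword set \<Rightarrow> 'a gword set set" where
  "refls w = {r \<in> carrier G. \<exists>ss. set ss \<subseteq> S \<and> cls ss = w \<and> par ss r}"

lemma refls_cls: "set ss \<subseteq> S \<Longrightarrow> r \<in> refls (cls ss) \<longleftrightarrow> r \<in> carrier G \<and> par ss r"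
  unfolding refls_def using par_cong by blast

lemma refls_one [simp]: "refls \<e> = {}"
  using refls_cls[of "[]"] by auto

lemma refls_gen: "s \<in> S \<Longrightarrow> refls (gen s) = {gen s}"
  using refls_cls[of "[s]"] by (auto simp: cls_single)

section \<open>Cocycle rule and strong exchange\<close>

lemma par_append:
  "set us \<subseteq> S \<Longrightarrow> r \<in> carrier G \<Longrightarrow>
    par (us @ vs) r = (par us r \<noteq> par vs (\<iota> (cls us) \<cdot> r \<cdot> cls us))"
  by (induction us arbitrary: r) (auto simp: cls_Cons inv_mult_group m_assoc)

lemma refls_mult:
  assumes "u \<in> carrier G" "v \<in> carrier G" "r \<in> carrier G"
  shows "r \<in> refls (u \<cdot> v) \<longleftrightarrow> (r \<in> refls u) \<noteq> (\<iota> u \<cdot> r \<cdot> u \<in> refls v)"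
proof -
  obtain us vs where *: "set us \<subseteq> S" "u = cls us" "set vs \<subseteq> S" "v = cls vs"
    using assms by (meson carrierE)
  have "refls (u \<cdot> v) = refls (cls (us @ vs))" using * by (simp add: cls_append)
  then show ?thesis using * assms(3) by (simp add: refls_cls par_append)
qed

text \<open>An odd number of occurrences is nonzero, so r is one of the reflections along the
  word.\<close>

lemma par_imp_split:
  "par ss r \<Longrightarrow> set ss \<subseteq> S \<Longrightarrow> r \<in> carrier G \<Longrightarrow>
    \<exists>us s vs. ss = us @ s # vs \<and> r = cls us \<cdot> gen s \<cdot> \<iota> (cls us)"
proof (induction ss arbitrary: r)
  case (Cons t ss)
  show ?case
  proof (cases "r = gen t")
    case True
    then show ?thesis using Cons.prems by (intro exI[of _ "[]"] exI[of _ t] exI[of _ ss]) simp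
  next
    case False
    then obtain us s vs where *: "ss = us @ s # vs"
      "gen t \<cdot> r \<cdot> gen t = cls us \<cdot> gen s \<cdot> \<iota> (cls us)"
      using Cons.IH[of "gen t \<cdot> r \<cdot> gen t"] Cons.prems by auto
    have "r = gen t \<cdot> (cls us \<cdot> gen s \<cdot> \<iota> (cls us)) \<cdot> gen t"
      using Cons.prems *(1) conj_eq_iff[of "gen t" r "cls us \<cdot> gen s \<cdot> \<iota> (cls us)"] *(2) by simp
    then have "r = cls (t # us) \<cdot> gen s \<cdot> \<iota> (cls (t # us))"
      using Cons.prems *(1) by (simp add: cls_Cons inv_mult_group m_assoc)
    then show ?thesis using *(1) by (intro exI[of _ "t # us"] exI[of _ s] exI[of _ vs]) simp
  qed
qed simp

text \<open>Strong exchange condition: with r = p s p^-1 for a prefix p followed by s, multiplying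
  by r on the left cancels that letter s.\<close>

lemma refls_delete:
  assumes "r \<in> refls (cls ss)" "set ss \<subseteq> S"
  obtains us s vs where "ss = us @ s # vs" "r = cls us \<cdot> gen s \<cdot> \<iota> (cls us)"
    "r \<cdot> cls ss = cls (us @ vs)"
proof -
  have r: "par ss r" "r \<in> carrier G" using assms by (auto simp: refls_cls)
  obtain us s vs where *: "ss = us @ s # vs" "r = cls us \<cdot> gen s \<cdot> \<iota> (cls us)"
    using par_imp_split[OF r(1) assms(2) r(2)] by auto
  have "r \<cdot> cls ss = cls (us @ vs)"
    using assms(2) by (simp add: * cls_append cls_Cons m_assoc)
  with * show ?thesis using that by blast
qed

lemma refls_length:
  assumes "r \<in> refls w" "w \<in> carrier G" shows "cox_length \<Gamma> (r \<cdot> w) < cox_length \<Gamma> w"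
proof -
  obtain ss where ss: "set ss \<subseteq> S" "w = cls ss" "length ss = cox_length \<Gamma> w"
    using assms(2) by (rule reduced_wordE)
  obtain us s vs where "ss = us @ s # vs" "r \<cdot> cls ss = cls (us @ vs)"
    using refls_delete[of r ss] assms(1) ss by metis
  then show ?thesis using cox_length_le[of "us @ vs"] ss by auto
qed

lemma refls_parabolic:
  assumes "X \<subseteq> S" "w \<in> cox_parabolic \<Gamma> X" "r \<in> refls w"
  shows "r \<in> cox_parabolic \<Gamma> X"
proof -
  interpret H: subgroup "cox_parabolic \<Gamma> X" G using assms(1) by (rule subgroup_parabolic)
  obtain ss where ss: "set ss \<subseteq> X" "w = cls ss" using assms parabolic_iff by blast
  have "r \<in> refls (cls ss)" "set ss \<subseteq> S" using assms ss by auto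
  then obtain us s vs where "ss = us @ s # vs" "r = cls us \<cdot> gen s \<cdot> \<iota> (cls us)"
    by (rule refls_delete)
  then show ?thesis using ss assms(1) by (auto intro!: cls_parabolic gen_parabolic)
qed

end


section \<open>Parabolic subgroups and reduced elements\<close>

context coxeter begin

text \<open>Induction on words in X, arranged so that each new letter is a left descent of the
  element it creates, as seen by N. All later arguments that peel off a first letter rest on this
  extra hypothesis.\<close>

lemma parabolic_induct [consumes 2, case_names one step]:
  assumes "X \<subseteq> S" "y \<in> cox_parabolic \<Gamma> X"
    and one: "P \<e>"
    and step: "\<And>s y. s \<in> X \<Longrightarrow> y \<in> cox_parabolic \<Gamma> X \<Longrightarrow> gen s \<in> refls (gen s \<cdot> y) \<Longrightarrow>
      P y \<Longrightarrow> P (gen s \<cdot> y)"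
  shows "P y"
proof -
  obtain ss where "set ss \<subseteq> X" "y = cls ss" using assms(1,2) parabolic_iff by auto
  then show ?thesis
  proof (induction "length ss" arbitrary: ss y rule: less_induct)
    case less
    show ?case
    proof (cases ss)
      case Nil
      then show ?thesis using one less.prems by simp
    next
      case (Cons s ys)
      then have s: "s \<in> S" "s \<in> X" "set ys \<subseteq> X" "set ys \<subseteq> S" using less.prems assms(1) by auto
      then have y: "y = gen s \<cdot> cls ys" using less.prems Cons by (simp add: cls_Cons)
      show ?thesis
      proof (cases "gen s \<in> refls (cls ys)")
        case True
        \<comment> \<open>Here s is already a descent of the rest of the word, so exchange produces
          a shorter word in X for the same element.\<close>
        from True s(4) obtain us t vs where "ys = us @ t # vs" "gen s \<cdot> cls ys = cls (us @ vs)"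
          by (rule refls_delete)
        then show ?thesis using s less.hyps[of "us @ vs" y] Cons y by auto
      next
        case False
        then have "gen s \<in> refls (gen s \<cdot> cls ys)"
          using s by (simp add: refls_mult refls_gen m_assoc)
        moreover have "P (cls ys)" using less.hyps[of ys] Cons s by simp
        ultimately show ?thesis
          using s assms(1) step[of s "cls ys"] y cls_parabolic[of ys X] by simp
      qed
    qed
  qed
qed

section \<open>Minimal coset representatives expressed through N\<close>

definition left_reduced :: "'a set \<Rightarrow> 'a gword set \<Rightarrow> bool" where
  "left_reduced T d \<longleftrightarrow> d \<in> carrier G \<and> (\<forall>r \<in> cox_parabolic \<Gamma> T. r \<notin> refls d)"

text \<open>Take a shortest element of the coset W_T w. A member of N lying in W_T would shorten it
  without leaving the coset.\<close>

lemma left_reduced_exists: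
  assumes "T \<subseteq> S" "w \<in> carrier G"
  shows "\<exists>a \<in> cox_parabolic \<Gamma> T. left_reduced T (\<iota> a \<cdot> w)"
proof -
  interpret H: subgroup "cox_parabolic \<Gamma> T" G using assms(1) by (rule subgroup_parabolic)
  obtain a where a: "a \<in> cox_parabolic \<Gamma> T"
    "\<And>b. b \<in> cox_parabolic \<Gamma> T \<Longrightarrow> cox_length \<Gamma> (\<iota> a \<cdot> w) \<le> cox_length \<Gamma> (\<iota> b \<cdot> w)"
    using ex_has_least_nat[of "\<lambda>a. a \<in> cox_parabolic \<Gamma> T" \<e> "\<lambda>a. cox_length \<Gamma> (\<iota> a \<cdot> w)"] by auto
  have "r \<notin> refls (\<iota> a \<cdot> w)" if r: "r \<in> cox_parabolic \<Gamma> T" for r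
  proof
    assume "r \<in> refls (\<iota> a \<cdot> w)"
    then have "cox_length \<Gamma> (r \<cdot> (\<iota> a \<cdot> w)) < cox_length \<Gamma> (\<iota> a \<cdot> w)"
      using a assms by (intro refls_length) auto
    moreover have "r \<cdot> (\<iota> a \<cdot> w) = \<iota> (a \<cdot> \<iota> r) \<cdot> w"
      using a(1) r assms(2) by (simp add: inv_mult_group m_assoc)
    ultimately show False using a(2)[of "a \<cdot> \<iota> r"] a(1) r by simp
  qed
  then show ?thesis using a(1) assms(2) unfolding left_reduced_def by auto
qed

text \<open>In the cocycle rule the second term asks whether a^-1 r a lies in N(d); this element is
  in W_T, which N(d) misses.\<close>

lemma refls_mult_left_reduced:
  assumes "T \<subseteq> S" "a \<in> cox_parabolic \<Gamma> T" "left_reduced T d" "r \<in> cox_parabolic \<Gamma> T"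
  shows "r \<in> refls (a \<cdot> d) \<longleftrightarrow> r \<in> refls a"
proof -
  interpret H: subgroup "cox_parabolic \<Gamma> T" G using assms(1) by (rule subgroup_parabolic)
  show ?thesis using assms by (simp add: refls_mult left_reduced_def)
qed

text \<open>A nontrivial a has a descent s in T, and N(a d) sees it as well by
  \<open>refls_mult_left_reduced\<close>.\<close>

lemma left_reduced_unique:
  assumes "T \<subseteq> S" "a \<in> cox_parabolic \<Gamma> T" "left_reduced T d"
    and "\<forall>t \<in> T. gen t \<notin> refls (a \<cdot> d)"
  shows "a = \<e>"
  using assms(1,2,4)
proof (induction rule: parabolic_induct)
  case (step s y)
  interpret H: subgroup "cox_parabolic \<Gamma> T" G using assms(1) by (rule subgroup_parabolic)
  have "gen s \<in> refls ((gen s \<cdot> y) \<cdot> d)"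
    using step assms by (subst refls_mult_left_reduced) (auto intro: gen_parabolic)
  then show ?case using step by auto
qed simp

text \<open>It suffices to test generators: factor d as a times a reduced element, then
  \<open>left_reduced_unique\<close> forces a = 1.\<close>

lemma left_reducedI:
  assumes "T \<subseteq> S" "d \<in> carrier G" "\<forall>t \<in> T. gen t \<notin> refls d"
  shows "left_reduced T d"
proof -
  obtain a where a: "a \<in> cox_parabolic \<Gamma> T" "left_reduced T (\<iota> a \<cdot> d)"
    using left_reduced_exists[OF assms(1,2)] by auto
  then have "a \<in> carrier G" using parabolic_carrier assms by auto
  then show ?thesis using left_reduced_unique[OF assms(1) a] assms a(2) by simp
qed

lemma double_coset_empty:
  assumes "X \<subseteq> S" "w \<in> carrier G"
  shows "(cox_parabolic \<Gamma> {} #>\<^bsub>G\<^esub> w) <#>\<^bsub>G\<^esub> cox_parabolic \<Gamma> X = {w \<cdot> y |y. y \<in> cox_parabolic \<Gamma> X}"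
proof -
  have "cox_parabolic \<Gamma> {} = {\<e>}"
    using parabolic_iff[of "{}"] by auto
  then show ?thesis using assms by (auto simp: r_coset_def set_mult_def)
qed

lemma cox_reduced_iff_length:
  assumes "X \<subseteq> S"
  shows "cox_reduced \<Gamma> {} X w \<longleftrightarrow> w \<in> carrier G \<and>
    (\<forall>y \<in> cox_parabolic \<Gamma> X. cox_length \<Gamma> w \<le> cox_length \<Gamma> (w \<cdot> y))"
  using assms by (auto simp: cox_reduced_def double_coset_empty)

text \<open>Right multiplication by r is left multiplication by w r w^-1, so a member of N(w) of
  that form gives a shorter element of w W_X. Conversely, choose w z shortest in w W_X and show z =
  1.\<close>

lemma cox_reduced_iff:
  assumes "X \<subseteq> S"
  shows "cox_reduced \<Gamma> {} X w \<longleftrightarrow> w \<in> carrier G \<and>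
    (\<forall>r \<in> cox_parabolic \<Gamma> X. w \<cdot> r \<cdot> \<iota> w \<notin> refls w)"
proof -
  interpret H: subgroup "cox_parabolic \<Gamma> X" G using assms(1) by (rule subgroup_parabolic)
  have imp: "w \<cdot> r \<cdot> \<iota> w \<notin> refls w"
    if "w \<in> carrier G" "r \<in> cox_parabolic \<Gamma> X"
      "\<forall>y \<in> cox_parabolic \<Gamma> X. cox_length \<Gamma> w \<le> cox_length \<Gamma> (w \<cdot> y)" for w r
  proof
    assume "w \<cdot> r \<cdot> \<iota> w \<in> refls w"
    from refls_length[OF this that(1)] that show False by (auto simp: m_assoc)
  qed
  moreover have "\<forall>y \<in> cox_parabolic \<Gamma> X. cox_length \<Gamma> w \<le> cox_length \<Gamma> (w \<cdot> y)"
    if w: "w \<in> carrier G" and r: "\<forall>r \<in> cox_parabolic \<Gamma> X. w \<cdot> r \<cdot> \<iota> w \<notin> refls w"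
  proof -
    obtain z where z: "z \<in> cox_parabolic \<Gamma> X"
      "\<And>y. y \<in> cox_parabolic \<Gamma> X \<Longrightarrow> cox_length \<Gamma> (w \<cdot> z) \<le> cox_length \<Gamma> (w \<cdot> y)"
      using ex_has_least_nat[of "\<lambda>a. a \<in> cox_parabolic \<Gamma> X" \<e> "\<lambda>a. cox_length \<Gamma> (w \<cdot> a)"] by auto
    have min: "\<forall>y \<in> cox_parabolic \<Gamma> X. cox_length \<Gamma> (w \<cdot> z) \<le> cox_length \<Gamma> (w \<cdot> z \<cdot> y)"
      using z w by (auto simp: m_assoc)
    have "z = \<e>"
      using assms z(1) min
    proof (induction rule: parabolic_induct)
      case (step s y)
      let ?z = "gen s \<cdot> y"
      let ?r = "w \<cdot> gen s \<cdot> \<iota> w"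
      have c: "s \<in> S" "y \<in> carrier G" "gen s \<in> carrier G" "gen s \<in> cox_parabolic \<Gamma> X"
        using step assms by (auto intro: gen_parabolic)
      \<comment> \<open>Cocycle rule for w = (w z) z^-1. A descent s of z contributes w s w^-1
        through N(z^-1), and minimality of w z keeps it out of N(w z). Hence it lies in N(w),
        against the assumption.\<close>
      have "?r \<in> refls ((w \<cdot> ?z) \<cdot> \<iota> ?z) \<longleftrightarrow>
          (?r \<in> refls (w \<cdot> ?z)) \<noteq> (\<iota> (w \<cdot> ?z) \<cdot> ?r \<cdot> (w \<cdot> ?z) \<in> refls (\<iota> ?z))"
        using c w by (intro refls_mult) auto
      moreover have "\<iota> (w \<cdot> ?z) \<cdot> ?r \<cdot> (w \<cdot> ?z) = \<iota> ?z \<cdot> gen s \<cdot> ?z"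
        using c w by (simp add: inv_mult_group m_assoc)
      moreover have "\<iota> ?z \<cdot> gen s \<cdot> ?z \<in> refls (\<iota> ?z)"
        using refls_mult[of ?z "\<iota> ?z" "gen s"] c step by (auto simp: m_assoc)
      moreover have "?r = (w \<cdot> ?z) \<cdot> (\<iota> ?z \<cdot> gen s \<cdot> ?z) \<cdot> \<iota> (w \<cdot> ?z)"
        using c w by (simp add: inv_mult_group m_assoc)
      then have "?r \<notin> refls (w \<cdot> ?z)"
        using imp[of "w \<cdot> ?z" "\<iota> ?z \<cdot> gen s \<cdot> ?z"] step c w by auto
      ultimately have "?r \<in> refls w" using c w by (simp add: m_assoc)
      then show ?case using r c(4) by blast
    qed simp
    then show ?thesis using z w by simp
  qed
  ultimately show ?thesis unfolding cox_reduced_iff_length[OF assms] by blast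
qed

section \<open>Monotonicity of the projection inside W\<close>

lemma left_reduced_one: "T \<subseteq> S \<Longrightarrow> left_reduced T \<e>"
  by (simp add: left_reduced_def)

text \<open>For left reduced d these are the standard generators of W_T \<inter> d W_X d^-1. The
  argument works with the inclusion \<open>conj_partD\<close> alone.\<close>

definition conj_part :: "'a set \<Rightarrow> 'a gword set \<Rightarrow> 'a set \<Rightarrow> 'a set" where
  "conj_part T d X = {t \<in> T. \<iota> d \<cdot> gen t \<cdot> d \<in> cox_parabolic \<Gamma> X}"

lemma conj_partD:
  assumes "T \<subseteq> S" "X \<subseteq> S" "d \<in> carrier G" "r \<in> cox_parabolic \<Gamma> (conj_part T d X)"
  shows "\<iota> d \<cdot> r \<cdot> d \<in> cox_parabolic \<Gamma> X"
proof -
  interpret H: subgroup "cox_parabolic \<Gamma> X" G using assms(2) by (rule subgroup_parabolic)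
  have sub: "conj_part T d X \<subseteq> S" using assms(1) by (auto simp: conj_part_def)
  show ?thesis using sub assms(4)
  proof (induction rule: parabolic_induct)
    case one
    then show ?case using assms by simp
  next
    case (step s y)
    then have s: "s \<in> S" "y \<in> carrier G" "\<iota> d \<cdot> gen s \<cdot> d \<in> cox_parabolic \<Gamma> X"
      using sub parabolic_carrier[OF sub] by (auto simp: conj_part_def)
    have "(\<iota> d \<cdot> gen s \<cdot> d) \<cdot> (\<iota> d \<cdot> y \<cdot> d) \<in> cox_parabolic \<Gamma> X"
      using step s by blast
    then show ?case using s assms(3) by (simp add: m_assoc)
  qed
qed

text \<open>The letters of a are removed one at a time. Each removal changes w inside W_Y, which is
  why the induction is over arbitrary w.\<close>

lemma parabolic_part_conj_part:
  assumes "T \<subseteq> S" "Y \<subseteq> S"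
    and "a \<in> cox_parabolic \<Gamma> T" "w \<in> cox_parabolic \<Gamma> Y"
    and "left_reduced T d" "left_reduced T e" "d \<cdot> w = a \<cdot> e"
  shows "a \<in> cox_parabolic \<Gamma> (conj_part T d Y)"
  using assms(1,3,4,7)
proof (induction arbitrary: w rule: parabolic_induct)
  case one
  have "conj_part T d Y \<subseteq> S" using assms(1) by (auto simp: conj_part_def)
  from subgroup.one_closed[OF subgroup_parabolic[OF this]] show ?case .
next
  case (step s y)
  interpret H: subgroup "cox_parabolic \<Gamma> Y" G using assms(2) by (rule subgroup_parabolic)
  interpret HT: subgroup "cox_parabolic \<Gamma> T" G using assms(1) by (rule subgroup_parabolic)
  have sub: "conj_part T d Y \<subseteq> S" using assms(1) by (auto simp: conj_part_def)
  have c: "s \<in> S" "gen s \<in> cox_parabolic \<Gamma> T" "y \<in> carrier G" "d \<in> carrier G" "e \<in> carrier G"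
      "w \<in> carrier G"
    using step assms by (auto intro: gen_parabolic simp: left_reduced_def)
  \<comment> \<open>The descent s of a lies in N(a e) = N(d w) but not in N(d), so its conjugate by
    d must come from N(w), which lies in W_Y.\<close>
  have "gen s \<in> refls (d \<cdot> w)"
    unfolding step.prems(2) using step c assms by (subst refls_mult_left_reduced) auto
  moreover have "gen s \<notin> refls d" using assms(5) c by (simp add: left_reduced_def)
  ultimately have "\<iota> d \<cdot> gen s \<cdot> d \<in> refls w" using c by (simp add: refls_mult)
  then have conj: "\<iota> d \<cdot> gen s \<cdot> d \<in> cox_parabolic \<Gamma> Y"
    using refls_parabolic[OF assms(2)] step.prems by blast
  then have "s \<in> conj_part T d Y" using step by (simp add: conj_part_def)
  \<comment> \<open>Cancelling s on the right-hand side amounts to replacing w by (d^-1 s d) w,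
    again an element of W_Y.\<close>
  moreover have "d \<cdot> (\<iota> d \<cdot> gen s \<cdot> d \<cdot> w) = y \<cdot> e"
    using c step.prems(2) by (simp add: m_assoc)
  then have "y \<in> cox_parabolic \<Gamma> (conj_part T d Y)"
    using step.IH[of "\<iota> d \<cdot> gen s \<cdot> d \<cdot> w"] conj step.prems(1) by blast
  ultimately show ?case
    using subgroup.m_closed[OF subgroup_parabolic[OF sub]] gen_parabolic by blast
qed

lemma projection_order:
  assumes T: "T \<subseteq> S" and Y: "Y \<subseteq> S" and XY: "X \<subseteq> Y"
    and a: "a \<in> cox_parabolic \<Gamma> T" and w: "w \<in> cox_parabolic \<Gamma> Y" "cox_reduced \<Gamma> {} X w"
    and red: "left_reduced T d" "left_reduced T e" and eq: "d \<cdot> w = a \<cdot> e"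
  shows "conj_part T e X \<subseteq> conj_part T d Y"
    and "r \<in> cox_parabolic \<Gamma> (conj_part T e X) \<Longrightarrow> a \<cdot> r \<cdot> \<iota> a \<notin> refls a"
proof -
  interpret H: subgroup "cox_parabolic \<Gamma> Y" G using Y by (rule subgroup_parabolic)
  interpret HT: subgroup "cox_parabolic \<Gamma> T" G using T by (rule subgroup_parabolic)
  have c: "a \<in> carrier G" "d \<in> carrier G" "e \<in> carrier G" "w \<in> carrier G"
    using a w red by (auto simp: left_reduced_def)
  have e: "e = \<iota> a \<cdot> d \<cdot> w" using eq c by (simp add: m_assoc)
  have b: "\<iota> d \<cdot> a \<cdot> d \<in> cox_parabolic \<Gamma> Y"
    by (rule conj_partD[OF T Y c(2) parabolic_part_conj_part[OF T Y a w(1) red eq]])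
  show "conj_part T e X \<subseteq> conj_part T d Y"
  proof
    fix t assume t: "t \<in> conj_part T e X"
    then have ct: "t \<in> T" "gen t \<in> carrier G" and x: "\<iota> e \<cdot> gen t \<cdot> e \<in> cox_parabolic \<Gamma> Y"
      using T parabolic_mono[OF XY] by (auto simp: conj_part_def)
    let ?b = "\<iota> d \<cdot> a \<cdot> d"
    \<comment> \<open>From e = a^-1 d w, the conjugates of t by e and by d differ by conjugation
      with w and d^-1 a d, and both of these lie in W_Y.\<close>
    have "\<iota> ?b \<cdot> (w \<cdot> (\<iota> e \<cdot> gen t \<cdot> e) \<cdot> \<iota> w) \<cdot> ?b \<in> cox_parabolic \<Gamma> Y"
      using b x w(1) by blast
    also have "\<iota> ?b \<cdot> (w \<cdot> (\<iota> e \<cdot> gen t \<cdot> e) \<cdot> \<iota> w) \<cdot> ?b = \<iota> d \<cdot> gen t \<cdot> d"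
      using c ct by (simp add: e m_assoc inv_mult_group)
    finally show "t \<in> conj_part T d Y" using ct by (simp add: conj_part_def)
  qed
  assume r: "r \<in> cox_parabolic \<Gamma> (conj_part T e X)"
  have rT: "r \<in> cox_parabolic \<Gamma> T"
    using r parabolic_mono[of "conj_part T e X" T] by (auto simp: conj_part_def)
  have x: "\<iota> e \<cdot> r \<cdot> e \<in> cox_parabolic \<Gamma> X"
    using conj_partD[OF T _ c(3) r] XY Y by blast
  show "a \<cdot> r \<cdot> \<iota> a \<notin> refls a"
  proof
    let ?q = "a \<cdot> r \<cdot> \<iota> a"
    \<comment> \<open>Such an element lies in N(d w) and not in N(d), so its conjugate by d lies in
      N(w). That conjugate is w x w^-1 with x in W_X, which contradicts the reducedness of
      w.\<close>
    assume "?q \<in> refls a"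
    moreover have q: "?q \<in> cox_parabolic \<Gamma> T" using a rT by blast
    ultimately have "?q \<in> refls (d \<cdot> w)"
      unfolding eq using refls_mult_left_reduced[OF T a red(2) q] by simp
    moreover have "?q \<notin> refls d" using red(1) q by (simp add: left_reduced_def)
    ultimately have "\<iota> d \<cdot> ?q \<cdot> d \<in> refls w" using c q by (simp add: refls_mult)
    also have "\<iota> d \<cdot> ?q \<cdot> d = w \<cdot> (\<iota> e \<cdot> r \<cdot> e) \<cdot> \<iota> w"
      using c HT.mem_carrier[OF rT] by (simp add: e m_assoc inv_mult_group)
    finally show False using w(2) x XY Y cox_reduced_iff[of X w] by blast
  qed
qed

end


section \<open>The geometric representation\<close>

text \<open>The bilinear form of Tits on simple roots; the entry m = 1 yields the diagonal value
  1.\<close>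

definition cox_form :: "'a coxeter_graph \<Rightarrow> 'a \<Rightarrow> 'a \<Rightarrow> real" where
  "cox_form \<Gamma> s t = (case mat \<Gamma> s t of enat m \<Rightarrow> - cos (pi / m) | \<infinity> \<Rightarrow> - 1)"

definition pairing :: "'a coxeter_graph \<Rightarrow> 'a \<Rightarrow> ('a \<Rightarrow> real) \<Rightarrow> real" where
  "pairing \<Gamma> s v = (\<Sum>t\<in>verts \<Gamma>. cox_form \<Gamma> s t * v t)"

text \<open>Vectors are given by coordinates in the basis of simple roots, so v - 2 B(alpha_s, v)
  alpha_s alters the coordinate s only.\<close>

definition reflect :: "'a coxeter_graph \<Rightarrow> 'a \<Rightarrow> ('a \<Rightarrow> real) \<Rightarrow> ('a \<Rightarrow> real)" where
  "reflect \<Gamma> s v = v(s := v s - 2 * pairing \<Gamma> s v)"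

definition simple_root :: "'a \<Rightarrow> 'a \<Rightarrow> real" where
  "simple_root s = (\<lambda>_. 0)(s := 1)"

text \<open>The word grows at its left end: every nonempty instance ends in t, and its first letter
  depends on the parity of the length.\<close>

fun alternating :: "'a \<Rightarrow> 'a \<Rightarrow> nat \<Rightarrow> 'a list" where
  "alternating s t 0 = []"
| "alternating s t (Suc k) = (if even k then t else s) # alternating s t k"

lemma length_alternating [simp]: "length (alternating s t k) = k"
  by (induction k) auto

lemma set_alternating: "set (alternating s t k) \<subseteq> {s, t}"
  by (induction k) auto

lemma last_alternating: "k > 0 \<Longrightarrow> last (alternating s t k) = t"
proof (induction k)
  case (Suc k)
  then show ?case by (cases k) simp_all
qed simp

lemma distinct_adj_alternating: "s \<noteq> t \<Longrightarrow> distinct_adj (alternating s t k)"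
proof (induction k)
  case (Suc k)
  then show ?case by (cases k) (auto simp: distinct_adj_Cons)
qed simp

lemma alternating_unique:
  assumes "distinct_adj xs" "set xs \<subseteq> {s, t}" "xs = [] \<or> last xs = t"
  shows "xs = alternating s t (length xs)"
  using assms
proof (induction xs)
  case (Cons a xs)
  show ?case
  proof (cases xs)
    case Nil
    then show ?thesis using Cons by simp
  next
    case (Cons b ys)
    then have "xs = alternating s t (length xs)" using Cons.IH Cons.prems by auto
    moreover have "a \<noteq> hd xs" "a = s \<or> a = t" using Cons.prems Cons by auto
    moreover have "hd xs = (if even (length ys) then t else s)"
      using calculation(1) Cons by auto
    ultimately show ?thesis using Cons by auto
  qed
qed simp

lemma alternating_double: "alternating s t (2 * m) = concat (replicate m [s, t])"
  by (induction m) auto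

lemma sin_recurrence:
  fixes \<theta> :: real
  shows "sin (real (Suc (Suc i)) * \<theta> + A) =
    2 * cos \<theta> * sin (real (Suc i) * \<theta> + A) - sin (real i * \<theta> + A)"
proof -
  let ?B = "real (Suc i) * \<theta> + A"
  have "real (Suc (Suc i)) * \<theta> + A = ?B + \<theta>" "real i * \<theta> + A = ?B - \<theta>"
    by (simp_all add: algebra_simps)
  then show ?thesis by (simp only: sin_add sin_diff) (simp add: algebra_simps)
qed

text \<open>Telescoping with 2 sin \<theta> sin A = cos (A - \<theta>) - cos (A + \<theta>).\<close>

lemma sum_sin_progression:
  "2 * sin \<theta> * (\<Sum>j<k. sin (2 * real j * \<theta> + \<phi>)) = cos (\<phi> - \<theta>) - cos (2 * real k * \<theta> + \<phi> - \<theta>)"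
proof (induction k)
  case (Suc k)
  let ?A = "2 * real k * \<theta> + \<phi>"
  have "cos (2 * real (Suc k) * \<theta> + \<phi> - \<theta>) = cos (?A + \<theta>)"
    by (simp add: algebra_simps)
  then have "2 * sin \<theta> * sin ?A = cos (?A - \<theta>) - cos (2 * real (Suc k) * \<theta> + \<phi> - \<theta>)"
    by (simp add: cos_add cos_diff)
  then show ?case using Suc by (simp add: distrib_left)
qed simp

lemma sum_sin_period:
  assumes "real m * \<theta> = pi" "sin \<theta> \<noteq> 0"
  shows "(\<Sum>j<m. sin (2 * real j * \<theta> + \<phi>)) = 0"
proof -
  have "2 * real m * \<theta> + \<phi> - \<theta> = \<phi> - \<theta> + 2 * pi"
    using assms(1) by simp
  then have "cos (2 * real m * \<theta> + \<phi> - \<theta>) = cos (\<phi> - \<theta> + 2 * pi)"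
    by (simp only:)
  then have "2 * sin \<theta> * (\<Sum>j<m. sin (2 * real j * \<theta> + \<phi>)) = 0"
    unfolding sum_sin_progression using cos_periodic[of "\<phi> - \<theta>"] by simp
  then show ?thesis using assms(2) by simp
qed

section \<open>The reflections satisfy the Coxeter relations\<close>

context coxeter begin

lemma form_self: "s \<in> S \<Longrightarrow> cox_form \<Gamma> s s = 1"
  using graph by (simp add: coxeter_graph_def cox_form_def one_enat_def)

lemma form_sym: "s \<in> S \<Longrightarrow> t \<in> S \<Longrightarrow> cox_form \<Gamma> s t = cox_form \<Gamma> t s"
  by (simp add: cox_form_def mat_sym)

lemma pairing_upd:
  assumes "s \<in> S"
  shows "pairing \<Gamma> r (v(s := x)) = pairing \<Gamma> r v + cox_form \<Gamma> r s * (x - v s)"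
  unfolding pairing_def
  using assms finite_S by (simp add: sum.remove[of _ s] algebra_simps)

lemma pairing_reflect:
  assumes "s \<in> S"
  shows "pairing \<Gamma> r (reflect \<Gamma> s v) = pairing \<Gamma> r v - 2 * cox_form \<Gamma> r s * pairing \<Gamma> s v"
  using assms by (simp add: reflect_def pairing_upd)

lemma reflect_reflect:
  assumes "s \<in> S" shows "reflect \<Gamma> s (reflect \<Gamma> s v) = v"
proof -
  have "pairing \<Gamma> s (reflect \<Gamma> s v) = - pairing \<Gamma> s v"
    using assms by (simp add: pairing_reflect form_self)
  then show ?thesis unfolding reflect_def[of _ _ "reflect \<Gamma> s v"] by (simp add: reflect_def)
qed

text \<open>The sequence x lists the amounts subtracted in turn, up to the factor 2: x (2 j) is the
  pairing with t before the j-th reflection in t, and x (2 j + 1) the pairing with s right after it.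
  Consecutive pairings obey a two-term recurrence, so the orbit is explicit without assuming that
  the form is nondegenerate.\<close>

lemma reflect_pow:
  fixes x :: "nat \<Rightarrow> real"
  assumes "s \<in> S" "t \<in> S" "s \<noteq> t"
    and x0: "x 0 = pairing \<Gamma> t v" and x1: "x 1 = pairing \<Gamma> s v + 2 * c * x 0"
    and rec: "\<And>i. x (Suc (Suc i)) = 2 * c * x (Suc i) - x i"
    and c: "cox_form \<Gamma> s t = - c"
  defines "u \<equiv> \<lambda>k. ((reflect \<Gamma> s \<circ> reflect \<Gamma> t) ^^ k) v"
  shows "u k = v(t := v t - 2 * (\<Sum>j<k. x (2 * j)), s := v s - 2 * (\<Sum>j<k. x (2 * j + 1))) \<and>
    pairing \<Gamma> t (u k) = x (2 * k) \<and> pairing \<Gamma> s (u k) + 2 * c * x (2 * k) = x (2 * k + 1)"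
proof (induction k)
  case 0
  then show ?case using x0 x1 by (simp add: u_def)
next
  case (Suc k)
  have ct: "cox_form \<Gamma> t s = - c" using c assms form_sym by simp
  have u: "u (Suc k) = reflect \<Gamma> s (reflect \<Gamma> t (u k))" by (simp add: u_def)
  have uk: "u k = v(t := v t - 2 * (\<Sum>j<k. x (2 * j)), s := v s - 2 * (\<Sum>j<k. x (2 * j + 1)))"
    and pt: "pairing \<Gamma> t (u k) = x (2 * k)"
    and ps': "pairing \<Gamma> s (u k) + 2 * c * x (2 * k) = x (2 * k + 1)"
    using Suc by blast+
  have ps: "pairing \<Gamma> s (reflect \<Gamma> t (u k)) = x (2 * k + 1)"
    using ps' pt assms(2) c by (simp add: pairing_reflect)
  have "u (Suc k) = v(t := v t - 2 * (\<Sum>j<Suc k. x (2 * j)),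
      s := v s - 2 * (\<Sum>j<Suc k. x (2 * j + 1)))"
  proof -
    have "u (Suc k) = (reflect \<Gamma> t (u k))(s := reflect \<Gamma> t (u k) s - 2 * x (2 * k + 1))"
      unfolding u by (subst reflect_def) (simp only: ps)
    moreover have "reflect \<Gamma> t (u k) = (u k)(t := u k t - 2 * x (2 * k))"
      by (subst reflect_def) (simp only: pt)
    ultimately show ?thesis using uk assms(3) by (simp add: fun_eq_iff)
  qed
  moreover have "pairing \<Gamma> t (u (Suc k)) = x (2 * Suc k)"
    unfolding u using pt ps assms c ct rec[of "2 * k"]
    by (simp add: pairing_reflect form_self)
  moreover have "pairing \<Gamma> s (u (Suc k)) + 2 * c * x (2 * Suc k) = x (2 * Suc k + 1)"
    using rec[of "2 * k + 1"] assms ps unfolding u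
    by (simp add: pairing_reflect[of s s] form_self)
  ultimately show ?case by blast
qed

lemma angle:
  assumes "s \<in> S" "t \<in> S" "s \<noteq> t" "mat \<Gamma> s t = enat m"
  shows "real m * (pi / m) = pi" "sin (pi / m) > 0" "m \<ge> 2"
proof -
  show m: "m \<ge> 2" using mat_ge_2[of s t] assms by (simp add: numeral_eq_enat)
  then show "real m * (pi / m) = pi" by simp
  show "sin (pi / m) > 0" using m by (intro sin_gt_zero) (auto simp: field_simps)
qed

lemma reflect_braid:
  assumes "s \<in> S" "t \<in> S" "s \<noteq> t" "mat \<Gamma> s t = enat m"
  shows "((reflect \<Gamma> s \<circ> reflect \<Gamma> t) ^^ m) v = v"
proof -
  define \<theta> where "\<theta> = pi / m"
  let ?p = "pairing \<Gamma> t v" and ?q = "pairing \<Gamma> s v"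
  \<comment> \<open>The solution of the recurrence with x 0 = p and x 1 = q + 2 cos \<theta> p. Over
    m rounds its even and odd terms each run through a full period and sum to zero, so the vector
    returns to its start.\<close>
  define x where "x i = (?p * sin (real i * \<theta> + \<theta>) + ?q * sin (real i * \<theta> + 0)) / sin \<theta>" for i :: nat
  have \<theta>: "real m * \<theta> = pi" "sin \<theta> > 0" using angle[OF assms] by (simp_all add: \<theta>_def)
  have rec: "x (Suc (Suc i)) = 2 * cos \<theta> * x (Suc i) - x i" for i
    unfolding x_def sin_recurrence[of i] using \<theta>(2) by (simp add: field_simps)
  have even: "(\<Sum>j<m. x (2 * j)) = 0"
  proof -
    have "(\<Sum>j<m. x (2 * j)) = (?p * (\<Sum>j<m. sin (2 * real j * \<theta> + \<theta>)) +
        ?q * (\<Sum>j<m. sin (2 * real j * \<theta> + 0))) / sin \<theta>"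
      by (simp add: x_def sum_distrib_left sum.distrib sum_divide_distrib add_divide_distrib)
    then show ?thesis using sum_sin_period[OF \<theta>(1), of 0] sum_sin_period[OF \<theta>(1), of \<theta>]
        sum_sin_period[OF \<theta>(1), of "2 * \<theta>"] \<theta>(2) by simp
  qed
  have odd: "(\<Sum>j<m. x (2 * j + 1)) = 0"
  proof -
    have "(\<Sum>j<m. x (2 * j + 1)) = (?p * (\<Sum>j<m. sin (2 * real j * \<theta> + 2 * \<theta>)) +
        ?q * (\<Sum>j<m. sin (2 * real j * \<theta> + \<theta>))) / sin \<theta>"
      by (simp add: x_def sum_distrib_left sum.distrib sum_divide_distrib add_divide_distrib
          distrib_right add_ac)
    then show ?thesis using sum_sin_period[OF \<theta>(1), of 0] sum_sin_period[OF \<theta>(1), of \<theta>]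
        sum_sin_period[OF \<theta>(1), of "2 * \<theta>"] \<theta>(2) by simp
  qed
  have x0: "x 0 = ?p" using \<theta> by (simp add: x_def)
  moreover have "x 1 = ?q + 2 * cos \<theta> * x 0"
    unfolding x0 using \<theta> sin_double[of \<theta>] by (simp add: x_def field_simps)
  moreover have "cox_form \<Gamma> s t = - cos \<theta>" using assms by (simp add: cox_form_def \<theta>_def)
  ultimately show ?thesis
    using reflect_pow[OF assms(1-3), of x v "cos \<theta>" m] rec even odd by simp
qed

abbreviation "act ss v \<equiv> foldr (reflect \<Gamma>) ss v"

lemma act_cong: "set ts \<subseteq> S \<Longrightarrow> cls ss = cls ts \<Longrightarrow> act ss v = act ts v"
  by (rule foldr_cong_cls[where D = UNIV]) (auto simp: reflect_reflect reflect_braid)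

section \<open>Roots of dihedral subgroups\<close>

lemma pairing_linear:
  "pairing \<Gamma> s (\<lambda>x. a * v x + b * w x) = a * pairing \<Gamma> s v + b * pairing \<Gamma> s w"
  by (simp add: pairing_def sum_distrib_left sum.distrib algebra_simps)

lemma act_linear: "act ss (\<lambda>x. a * v x + b * w x) = (\<lambda>x. a * act ss v x + b * act ss w x)"
proof (induction ss)
  case (Cons s ss)
  show ?case unfolding foldr.simps comp_def Cons
    by (simp add: reflect_def pairing_linear fun_eq_iff algebra_simps)
qed simp

lemma pairing_root: "s \<in> S \<Longrightarrow> pairing \<Gamma> t (simple_root s) = cox_form \<Gamma> t s"
  unfolding simple_root_def by (subst pairing_upd) (auto simp: pairing_def)

lemma pairing_root2:
  assumes "s \<in> S" "t \<in> S" "s \<noteq> t"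
  shows "pairing \<Gamma> r ((\<lambda>_. 0)(s := a, t := b)) = a * cox_form \<Gamma> r s + b * cox_form \<Gamma> r t"
  using assms by (simp add: pairing_upd) (simp add: pairing_def)

text \<open>Each reflection replaces the older of the two coefficients by 2 c times the newer minus
  the older. The letters s and t therefore exchange roles with the parity of k.\<close>

lemma act_alternating:
  fixes a :: "nat \<Rightarrow> real"
  assumes "s \<in> S" "t \<in> S" "s \<noteq> t" "cox_form \<Gamma> s t = - c"
    and "a 0 = 0" "a 1 = 1" "\<And>i. a (Suc (Suc i)) = 2 * c * a (Suc i) - a i"
  shows "act (alternating s t k) (simple_root s) =
    (\<lambda>_. 0)(s := if even k then a (Suc k) else a k, t := if even k then a k else a (Suc k))"
proof (induction k)
  case 0
  then show ?case using assms by (auto simp: simple_root_def)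
next
  case (Suc k)
  have "cox_form \<Gamma> t s = - c" using assms form_sym by simp
  then show ?case
    unfolding alternating.simps foldr.simps comp_def Suc
    using assms by (auto simp: reflect_def pairing_root2 form_self fun_eq_iff)
qed

text \<open>The coefficients are a_i = sin (i \<theta>) / sin \<theta> with \<theta> = pi / m, or
  their limit i for infinite m. Both a_k and a_(k+1) occur, and sin (i \<theta>) is nonnegative as
  far as i = m, whence the bound k < m.\<close>

lemma act_alternating_nonneg:
  assumes "s \<in> S" "t \<in> S" "s \<noteq> t" and k: "\<And>m. mat \<Gamma> s t = enat m \<Longrightarrow> k < m"
  shows "\<exists>a b. a \<ge> 0 \<and> b \<ge> 0 \<and>
    act (alternating s t k) (simple_root s) = (\<lambda>x. a * simple_root s x + b * simple_root t x)"
proof -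
  have "\<exists>a c. cox_form \<Gamma> s t = - c \<and> a 0 = (0::real) \<and> a 1 = 1 \<and>
    (\<forall>i. a (Suc (Suc i)) = 2 * c * a (Suc i) - a i) \<and> a k \<ge> 0 \<and> a (Suc k) \<ge> 0"
  proof (cases "mat \<Gamma> s t")
    case (enat m)
    define \<theta> where "\<theta> = pi / m"
    have \<theta>: "real m * \<theta> = pi" "sin \<theta> > 0" "\<theta> > 0"
      using angle[OF assms(1-3) enat] by (simp_all add: \<theta>_def)
    have nonneg: "sin (real i * \<theta>) \<ge> 0" if "i \<le> m" for i
      using that \<theta> mult_right_mono[of "real i" "real m" \<theta>] by (intro sin_ge_zero) auto
    have "\<forall>i. sin (real (Suc (Suc i)) * \<theta>) / sin \<theta> =
        2 * cos \<theta> * (sin (real (Suc i) * \<theta>) / sin \<theta>) - sin (real i * \<theta>) / sin \<theta>"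
      using sin_recurrence[of _ \<theta> 0] by (simp add: diff_divide_distrib del: of_nat_Suc)
    then show ?thesis
      using \<theta> k[OF enat] nonneg[of k] nonneg[of "Suc k"] enat
      by (intro exI[of _ "\<lambda>i. sin (real i * \<theta>) / sin \<theta>"] exI[of _ "cos \<theta>"])
         (simp add: cox_form_def \<theta>_def)
  next
    case infinity
    then show ?thesis
      by (intro exI[of _ "\<lambda>i. real i"] exI[of _ 1]) (simp add: cox_form_def)
  qed
  then obtain a c where ac: "cox_form \<Gamma> s t = - c" "a 0 = (0::real)" "a 1 = 1"
    "\<And>i. a (Suc (Suc i)) = 2 * c * a (Suc i) - a i" "a k \<ge> 0" "a (Suc k) \<ge> 0" by auto
  have "act (alternating s t k) (simple_root s) = (\<lambda>x.
      (if even k then a (Suc k) else a k) * simple_root s x +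
      (if even k then a k else a (Suc k)) * simple_root t x)"
    unfolding act_alternating[OF assms(1-3) ac(1-4)] using assms(3)
    by (auto simp: simple_root_def)
  moreover have "(if even k then a (Suc k) else a k) \<ge> 0" "(if even k then a k else a (Suc k)) \<ge> 0"
    using ac(5,6) by simp_all
  ultimately show ?thesis by blast
qed

lemma alternating_braid:
  assumes "s \<in> S" "t \<in> S" "s \<noteq> t" "mat \<Gamma> s t = enat m"
  shows "cls (alternating s t m) = cls (alternating t s m)"
proof -
  \<comment> \<open>The relator (s t)^m is cut in half. The second half ends in t; the first begins
    with s, so its reverse, which represents its inverse, ends in s.\<close>
  let ?p = "take m (alternating s t (2 * m))" and ?d = "drop m (alternating s t (2 * m))"
  have m: "m \<ge> 2" using angle assms by blast
  have pd: "?p @ ?d = alternating s t (2 * m)" by simp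
  have adj: "distinct_adj ?p" "distinct_adj ?d"
    using distinct_adj_alternating[OF assms(3), of "2 * m"] pd
    by (metis distinct_adj_appendD1, metis distinct_adj_appendD2)
  have sets: "set ?p \<subseteq> {s, t}" "set ?d \<subseteq> {s, t}"
    using set_alternating[of s t "2 * m"] set_take_subset[of m "alternating s t (2 * m)"]
      set_drop_subset[of m "alternating s t (2 * m)"] by auto
  have "last ?d = t" using m last_alternating[of "2 * m" s t] by (simp add: last_drop)
  then have d: "?d = alternating s t m" using alternating_unique[OF adj(2) sets(2)] by simp
  have "hd ?p = s" using m by (cases m) (simp_all add: alternating_double)
  then have "last (rev ?p) = s" by (simp add: last_rev)
  then have p: "rev ?p = alternating t s m"
    using alternating_unique[of "rev ?p" t s] adj sets by auto
  have S: "set ?p \<subseteq> S" "set ?d \<subseteq> S" using sets assms by auto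
  have "cls ?p \<cdot> cls ?d = \<e>"
    using gen_mult_pow[OF assms] cls_append[OF S] pd by (simp add: alternating_double)
  then have "cls ?d = cls (rev ?p)"
    using S by (metis cls_closed cls_rev inv_equality inv_inv)
  then show ?thesis using p d by simp
qed

lemma cox_length_append_gen_less:
  assumes "set us \<subseteq> S" "s \<in> S" "cls us = cls (vs @ [s])" "set vs \<subseteq> S"
  shows "cox_length \<Gamma> (cls (us @ [s])) \<le> length vs"
proof -
  have "cls (us @ [s]) = cls vs"
    using assms by (simp add: cls_append cls_single m_assoc)
  then show ?thesis using cox_length_le[OF assms(4)] by simp
qed

end

section \<open>Positivity of roots and faithfulness\<close>

context coxeter begin

lemma reduced_prefix:
  assumes "set us \<subseteq> S" "set vs \<subseteq> S" "length (us @ vs) = cox_length \<Gamma> (cls (us @ vs))"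
  shows "length us = cox_length \<Gamma> (cls us)" "length vs = cox_length \<Gamma> (cls vs)"
proof -
  obtain us' where u: "set us' \<subseteq> S" "cls us = cls us'" "length us' = cox_length \<Gamma> (cls us)"
    using reduced_wordE[of "cls us"] assms(1) by auto
  have "cls (us' @ vs) = cls (us @ vs)" using u assms by (simp add: cls_append)
  then show "length us = cox_length \<Gamma> (cls us)"
    using cox_length_le[of "us' @ vs"] cox_length_le[of us] u assms by simp
  obtain vs' where v: "set vs' \<subseteq> S" "cls vs = cls vs'" "length vs' = cox_length \<Gamma> (cls vs)"
    using reduced_wordE[of "cls vs"] assms(2) by auto
  have "cls (us @ vs') = cls (us @ vs)" using v assms by (simp add: cls_append)
  then show "length vs = cox_length \<Gamma> (cls vs)"
    using cox_length_le[of "us @ vs'"] cox_length_le[of vs] v assms by simp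
qed

lemma reduced_distinct_adj:
  assumes "set ss \<subseteq> S" "length ss = cox_length \<Gamma> (cls ss)"
  shows "distinct_adj ss"
proof (rule ccontr)
  assume "\<not> distinct_adj ss"
  then obtain us s vs where ss: "ss = us @ s # s # vs"
  proof (induction ss arbitrary: thesis)
    case (Cons a ss)
    show ?case
    proof (cases "distinct_adj ss")
      case True
      then obtain ys where "ss = a # ys" using Cons.prems(2)
        by (cases ss) (auto simp: distinct_adj_Cons)
      then show ?thesis using Cons.prems(1)[of "[]" a ys] by simp
    next
      case False
      then obtain us s vs where "ss = us @ s # s # vs" using Cons.IH by blast
      then show ?thesis using Cons.prems(1)[of "a # us" s vs] by simp
    qed
  qed simp
  then have "cls ss = cls (us @ vs)"
    using assms(1) by (simp add: cls_append cls_Cons)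
  then show False using cox_length_le[of "us @ vs"] assms ss by simp
qed

text \<open>Among all factorisations
  \<open>w = v x\<close> with \<open>x\<close> in the dihedral group of \<open>s\<close> and a right descent \<open>t\<close> of \<open>w\<close> and with lengths adding
  up, take one with \<open>x\<close> longest; then the induction hypothesis applies to \<open>v\<close>, and \<open>x\<close> is treated by hand.\<close>

lemma act_simple_root_nonneg:
  assumes "set ss \<subseteq> S" "length ss = cox_length \<Gamma> (cls ss)"
    and "s \<in> S" "length ss \<le> cox_length \<Gamma> (cls (ss @ [s]))"
  shows "act ss (simple_root s) x \<ge> 0"
  using assms
proof (induction "length ss" arbitrary: ss s x rule: less_induct)
  case less
  show ?case
  proof (cases "ss = []")
    case True
    then show ?thesis by (simp add: simple_root_def)
  next
    case False
    define t where "t = last ss"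
    have ss: "ss = butlast ss @ [t]" using False by (simp add: t_def)
    have t: "t \<in> S" "set (butlast ss) \<subseteq> S"
      using less.prems(1) False by (auto simp: t_def dest: in_set_butlastD)
    \<comment> \<open>Such a word would give \<open>ss @ [s]\<close> a length below that of
      \<open>ss\<close>.\<close>
    have ascent: False if "set us \<subseteq> S" "cls ss = cls (us @ [s])" "length us < length ss" for us
      using cox_length_append_gen_less[OF less.prems(1,3) that(2,1)] less.prems(4) that(3) by simp
    have st: "s \<noteq> t" using ascent[of "butlast ss"] t ss False by auto
    let ?P = "\<lambda>k. \<exists>vs xs. cls ss = cls (vs @ xs) \<and> set vs \<subseteq> S \<and> set xs \<subseteq> {s, t} \<and>
      length vs + length xs = length ss \<and> length xs = k"
    have "cls ss = cls (butlast ss @ [t]) \<and> set (butlast ss) \<subseteq> S \<and> set [t] \<subseteq> {s, t} \<and>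
        length (butlast ss) + length [t] = length ss \<and> length [t] = 1"
      using arg_cong[OF ss, of cls] t False by simp
    then have P1: "?P 1" by blast
    have "\<forall>k. ?P k \<longrightarrow> k \<le> length ss" by auto
    with P1 obtain k where k: "?P k" "\<And>j. ?P j \<Longrightarrow> j \<le> k"
      using GreatestI_nat[of ?P 1 "length ss"] Greatest_le_nat[of ?P _ "length ss"] by blast
    then obtain vs xs where vx: "cls ss = cls (vs @ xs)" "set vs \<subseteq> S" "set xs \<subseteq> {s, t}"
      "length vs + length xs = length ss" "length xs = k" by blast
    have k1: "k \<ge> 1" using k(2) P1 by blast
    have xS: "set xs \<subseteq> S" using vx t less.prems by auto
    have vx_red: "length (vs @ xs) = cox_length \<Gamma> (cls (vs @ xs))"
      using vx less.prems by simp
    note red = reduced_prefix[OF vx(2) xS vx_red]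
    \<comment> \<open>If r shortened v, then v = v' r, and moving r to the front of x would give a
      longer x with lengths still adding up, because \<open>ss\<close> is reduced.\<close>
    have v_ascent: "length vs \<le> cox_length \<Gamma> (cls (vs @ [r]))" if r: "r \<in> {s, t}" for r
    proof (rule ccontr)
      assume less': "\<not> ?thesis"
      have rS: "r \<in> S" using r t less.prems by auto
      obtain vs' where v': "set vs' \<subseteq> S" "cls (vs @ [r]) = cls vs'"
          "length vs' = cox_length \<Gamma> (cls (vs @ [r]))"
        using reduced_wordE[of "cls (vs @ [r])"] vx rS by auto
      have "cls vs = cls (vs' @ [r])"
        using v'(1) v'(2)[symmetric] vx(2) rS by (simp add: cls_append cls_single m_assoc)
      then have eq: "cls (vs' @ r # xs) = cls ss"
        using vx(1,2) v'(1) rS xS cls_append[of "vs' @ [r]" xs] cls_append[of vs xs] by simp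
      then have "length ss \<le> length vs' + Suc k"
        using cox_length_le[of "vs' @ r # xs"] v' rS xS vx(5) less.prems(2) by simp
      then have "length vs' + Suc k = length ss" using less' v' vx(4,5) by simp
      then have "cls ss = cls (vs' @ (r # xs)) \<and> set vs' \<subseteq> S \<and> set (r # xs) \<subseteq> {s, t} \<and>
          length vs' + length (r # xs) = length ss \<and> length (r # xs) = Suc k"
        using eq v'(1) r vx(3,5) by simp
      then have "?P (Suc k)" by blast
      then show False using k(2)[of "Suc k"] by simp
    qed
    have lastx: "last xs = t"
    proof (rule ccontr)
      assume "last xs \<noteq> t"
      moreover have "xs \<noteq> []" using k1 vx by auto
      ultimately have xs: "xs = butlast xs @ [s]" using vx(3)
        by (metis append_butlast_last_id empty_iff insert_iff last_in_set subset_iff)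
      show False
      proof (rule ascent[of "vs @ butlast xs"])
        show "set (vs @ butlast xs) \<subseteq> S" using vx(2) xS by (auto dest: in_set_butlastD)
        show "cls ss = cls ((vs @ butlast xs) @ [s])" using vx(1) xs by simp
        show "length (vs @ butlast xs) < length ss" using vx(4,5) k1 by simp
      qed
    qed
    then have x_alt: "xs = alternating s t k"
      using alternating_unique[OF reduced_distinct_adj[OF xS red(2)] vx(3)] vx(5) by simp
    \<comment> \<open>Otherwise the last m letters of x form one side of a braid relation; its other
      side ends in s, which \<open>ascent\<close> forbids.\<close>
    have "k < m" if m: "mat \<Gamma> s t = enat m" for m
    proof (rule ccontr)
      assume "\<not> k < m"
      have m2: "m \<ge> 2" using angle[OF less.prems(3) t(1) st m] by simp
      have "\<exists>ps. xs = ps @ alternating s t m"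
      proof -
        have "\<exists>ps. alternating s t (m + j) = ps @ alternating s t m" for j
        proof (induction j)
          case (Suc j)
          then obtain ps where "alternating s t (m + j) = ps @ alternating s t m" by auto
          then show ?case
            by (intro exI[of _ "(if even (m + j) then t else s) # ps"]) simp
        qed simp
        from this[of "k - m"] \<open>\<not> k < m\<close> show ?thesis by (simp add: x_alt)
      qed
      then obtain ps where ps: "xs = ps @ alternating s t m" by auto
      have mS: "set (alternating s t m) \<subseteq> S" "set (alternating t s m) \<subseteq> S"
        using set_alternating[of s t m] set_alternating[of t s m] t less.prems by auto
      let ?b = "butlast (alternating t s m)"
      have b: "alternating t s m = ?b @ [s]"
        using last_alternating[of m t s] m2
        by (metis append_butlast_last_id length_alternating list.size(3) not_numeral_le_zero
            not_gr_zero)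
      have "cls ss = cls ((vs @ ps @ ?b) @ [s])"
        using vx(1,2) xS mS alternating_braid[OF less.prems(3) t(1) st m] b ps
          cls_append[of "vs @ ps" "alternating s t m"] cls_append[of "vs @ ps" "alternating t s m"]
        by simp
      moreover have "length (vs @ ps @ ?b) < length ss"
        using vx(4) ps m2 by simp
      moreover have "set (vs @ ps @ ?b) \<subseteq> S"
        using vx(2) xS ps mS by (auto dest: in_set_butlastD)
      ultimately show False using ascent by blast
    qed
    then obtain a b where ab: "a \<ge> 0" "b \<ge> 0"
      "act xs (simple_root s) = (\<lambda>x. a * simple_root s x + b * simple_root t x)"
      using act_alternating_nonneg[OF less.prems(3) t(1) st] x_alt by blast
    have "act ss (simple_root s) = act (vs @ xs) (simple_root s)"
      using vx xS by (intro act_cong) auto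
    also have "\<dots> = (\<lambda>x. a * act vs (simple_root s) x + b * act vs (simple_root t) x)"
      by (simp add: ab(3) act_linear)
    finally have eq: "act ss (simple_root s) x =
      a * act vs (simple_root s) x + b * act vs (simple_root t) x" by simp
    have "length vs < length ss" using vx(4,5) k1 by simp
    then have "act vs (simple_root s) x \<ge> 0" "act vs (simple_root t) x \<ge> 0"
      using less.hyps[of vs s x] less.hyps[of vs t x] vx(2) red(1) v_ascent t less.prems(3)
      by auto
    then show ?thesis unfolding eq using ab by simp
  qed
qed

text \<open>A nonempty reduced word u s sends alpha_s to -u alpha_s, whose coordinate at s is at
  most 0 by positivity, while alpha_s has coordinate 1 there.\<close>

lemma act_faithful:
  assumes "set ss \<subseteq> S" "\<And>s. s \<in> S \<Longrightarrow> act ss (simple_root s) = simple_root s"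
  shows "cls ss = \<e>"
proof -
  obtain ts where ts: "set ts \<subseteq> S" "cls ss = cls ts" "length ts = cox_length \<Gamma> (cls ss)"
    using reduced_wordE[of "cls ss"] assms(1) by auto
  have "ts = []"
  proof (rule ccontr)
    assume "ts \<noteq> []"
    define s where "s = last ts"
    define us where "us = butlast ts"
    have eq: "ts = us @ [s]" using \<open>ts \<noteq> []\<close> by (simp add: s_def us_def)
    then have S: "set us \<subseteq> S" "s \<in> S" using ts by auto
    have red: "length us = cox_length \<Gamma> (cls us)"
      using reduced_prefix(1)[of us "[s]"] S ts eq by simp
    have "act us (simple_root s) s \<ge> 0"
      using ts eq by (intro act_simple_root_nonneg S red) simp
    \<comment> \<open>The summand with coefficient 0 puts -alpha_s into the shape that
      \<open>act_linear\<close> expects.\<close>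
    moreover have "reflect \<Gamma> s (simple_root s) = (\<lambda>x. - 1 * simple_root s x + 0 * simple_root s x)"
      using S pairing_root[of s s] form_self[of s]
      by (auto simp: reflect_def fun_eq_iff simple_root_def)
    then have "act ts (simple_root s) s = - act us (simple_root s) s"
      unfolding eq by (simp only: foldr_append foldr.simps comp_def id_def act_linear)
    moreover have "act ts (simple_root s) = simple_root s"
      using assms(2)[OF S(2)] act_cong[OF ts(1,2)] by simp
    ultimately show False by (simp add: simple_root_def)
  qed
  then show ?thesis using ts by simp
qed

lemma gen_inject:
  assumes "s \<in> S" "t \<in> S" "gen s = gen t" shows "s = t"
proof (rule ccontr)
  assume "s \<noteq> t"
  have "act [s] (simple_root s) = act [t] (simple_root s)"
    using assms by (intro act_cong) (auto simp: cls_single)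
  then have "reflect \<Gamma> s (simple_root s) s = reflect \<Gamma> t (simple_root s) s" by simp
  then show False
    using \<open>s \<noteq> t\<close> assms pairing_root[of s s] form_self[of s] by (simp add: reflect_def)
qed

text \<open>A first letter s in X chosen by \<open>parabolic_induct\<close> lies in N(t) = {t}, and
  distinct letters are distinct in W by \<open>gen_inject\<close>.\<close>

lemma gen_in_parabolic:
  assumes "X \<subseteq> S" "t \<in> S" "gen t \<in> cox_parabolic \<Gamma> X" shows "t \<in> X"
proof -
  have ne: "gen t \<noteq> \<e>" using refls_gen[OF assms(2)] by auto
  have "y = gen t \<longrightarrow> t \<in> X" if "y \<in> cox_parabolic \<Gamma> X" for y
    using assms(1) that
  proof (induction rule: parabolic_induct)
    case one
    then show ?case using ne by simp
  next
    case (step s y)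
    then show ?case using refls_gen[OF assms(2)] gen_inject[of s t] assms by auto
  qed
  then show ?thesis using assms(3) by blast
qed

end


section \<open>Standard parabolic subgroups and the projection\<close>

lemma verts_sub [simp]: "verts (\<Gamma> \<restriction>\<^sub>C T) = T"
  by (simp add: sub_coxeter_graph_def)

lemma mat_sub: "s \<in> T \<Longrightarrow> t \<in> T \<Longrightarrow> mat (\<Gamma> \<restriction>\<^sub>C T) s t = mat \<Gamma> s t"
  by (simp add: sub_coxeter_graph_def)

lemma sub_sub: "R \<subseteq> T \<Longrightarrow> (\<Gamma> \<restriction>\<^sub>C T) \<restriction>\<^sub>C R = \<Gamma> \<restriction>\<^sub>C R"
  by (auto simp: sub_coxeter_graph_def fun_eq_iff)

lemma coxeter_sub_graph: "coxeter_graph \<Gamma> \<Longrightarrow> T \<subseteq> verts \<Gamma> \<Longrightarrow> coxeter_graph (\<Gamma> \<restriction>\<^sub>C T)"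
  unfolding coxeter_graph_def by (auto simp: sub_coxeter_graph_def finite_subset subset_iff)

lemma presentation_rel_mono:
  assumes "S \<subseteq> S'" "R \<subseteq> R'"
  shows "presentation_rel S R \<subseteq> presentation_rel S' R'"
proof -
  have w: "gwords S \<subseteq> gwords S'" using assms(1) by (auto simp: gwords_def)
  have "(u, v) \<in> presentation_rel S' R'" if "(u, v) \<in> presentation_rel S R" for u v
    using that
  proof (induction rule: presentation_rel.induct)
    case (trans u v w)
    show ?case using trans.IH by (rule presentation_rel.trans)
  qed (use assms w in \<open>auto intro: presentation_rel.refl presentation_rel.sym
      presentation_rel.append presentation_rel.cancel presentation_rel.relator\<close>)
  then show ?thesis by auto
qed

lemma cox_rel_sub:
  assumes "T \<subseteq> verts \<Gamma>" shows "cox_rel (\<Gamma> \<restriction>\<^sub>C T) \<subseteq> cox_rel \<Gamma>"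
proof -
  have "coxeter_relators (\<Gamma> \<restriction>\<^sub>C T) \<subseteq> coxeter_relators \<Gamma>"
  proof
    fix r assume "r \<in> coxeter_relators (\<Gamma> \<restriction>\<^sub>C T)"
    then consider s where "s \<in> T" "r = [(s, True), (s, True)]"
      | s t n where "s \<in> T" "t \<in> T" "s \<noteq> t" "mat \<Gamma> s t = enat n"
          "r = concat (replicate n [(s, True), (t, True)])"
      unfolding coxeter_relators_def by (auto simp: mat_sub)
    then show "r \<in> coxeter_relators \<Gamma>"
      using assms unfolding coxeter_relators_def by cases blast+
  qed
  then show ?thesis unfolding cox_rel_def using assms by (intro presentation_rel_mono) simp_all
qed

section \<open>W_T with its own presentation, embedded into W\<close>

locale coxeter_sub = coxeter +
  fixes T :: "'a set"
  assumes T: "T \<subseteq> S"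
begin

sublocale sub: coxeter "\<Gamma> \<restriction>\<^sub>C T"
  by unfold_locales (rule coxeter_sub_graph[OF graph T])

abbreviation "H \<equiv> cox_group (\<Gamma> \<restriction>\<^sub>C T)"

lemma sub_wordE:
  assumes "a \<in> carrier H" obtains ss where "set ss \<subseteq> T" "a = sub.cls ss"
  using assms by (elim sub.carrierE) simp

lemma incl_cls:
  assumes "set ss \<subseteq> T" shows "cox_incl \<Gamma> (sub.cls ss) = cls ss"
proof
  let ?w = "map (\<lambda>s. (s, True)) ss"
  have sub: "cox_rel (\<Gamma> \<restriction>\<^sub>C T) \<subseteq> cox_rel \<Gamma>" using T by (rule cox_rel_sub)
  show "cox_incl \<Gamma> (sub.cls ss) \<subseteq> cls ss"
    using sub equiv_cox_rel unfolding cox_incl_def sub.cls_def cls_def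
    by (auto simp: equiv_def elim: transE)
  have "(?w, ?w) \<in> cox_rel (\<Gamma> \<restriction>\<^sub>C T)"
    using sub.word_gwords[of ss] assms unfolding cox_rel_def by (simp add: presentation_rel.refl)
  then show "cls ss \<subseteq> cox_incl \<Gamma> (sub.cls ss)"
    unfolding cox_incl_def sub.cls_def cls_def by auto
qed

text \<open>Vectors supported on T form the subrepresentation that is the geometric representation
  of W_T.\<close>

lemma reflect_sub:
  assumes "s \<in> T" "\<And>x. x \<notin> T \<Longrightarrow> v x = 0"
  shows "reflect (\<Gamma> \<restriction>\<^sub>C T) s v = reflect \<Gamma> s v"
proof -
  have "pairing (\<Gamma> \<restriction>\<^sub>C T) s v = pairing \<Gamma> s v"
    unfolding pairing_def verts_sub
    using assms T finite_S by (intro sum.mono_neutral_cong_left) (auto simp: cox_form_def mat_sub)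
  then show ?thesis by (simp add: reflect_def)
qed

lemma act_sub:
  "set ss \<subseteq> T \<Longrightarrow> (\<And>x. x \<notin> T \<Longrightarrow> v x = 0) \<Longrightarrow>
    sub.act ss v = act ss v \<and> (\<forall>x. x \<notin> T \<longrightarrow> act ss v x = 0)"
proof (induction ss)
  case (Cons s ss)
  then have IH: "sub.act ss v = act ss v" "\<And>x. x \<notin> T \<Longrightarrow> act ss v x = 0" and s: "s \<in> T" by auto
  have "reflect (\<Gamma> \<restriction>\<^sub>C T) s (act ss v) = reflect \<Gamma> s (act ss v)"
    using s IH(2) by (rule reflect_sub)
  moreover have "reflect \<Gamma> s (act ss v) x = 0" if "x \<notin> T" for x
    using that s IH(2)[OF that] by (auto simp: reflect_def[of \<Gamma> s "act ss v"])
  ultimately show ?case by (simp add: IH(1))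
qed simp

text \<open>If the two words agree in W, \<open>ss @ rev ts\<close> acts trivially on every vector,
  in particular on those supported on T, where W_T acts faithfully.\<close>

lemma cls_sub_inject:
  assumes "set ss \<subseteq> T" "set ts \<subseteq> T" "cls ss = cls ts"
  shows "sub.cls ss = sub.cls ts"
proof -
  have S: "set ss \<subseteq> S" "set ts \<subseteq> S" using assms T by auto
  let ?w = "ss @ rev ts"
  have "cls ?w = cls []" using assms S by (simp add: cls_append cls_rev)
  then have id: "act ?w v = v" for v using act_cong[of "[]" ?w v] by simp
  have "sub.act ?w (simple_root s) = simple_root s" if "s \<in> T" for s
    using act_sub[of ?w "simple_root s"] that assms id[of "simple_root s"]
    by (simp add: simple_root_def split: if_splits) metis
  then have "sub.cls ?w = \<one>\<^bsub>H\<^esub>" using assms by (intro sub.act_faithful) auto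
  then have "sub.cls ss \<otimes>\<^bsub>H\<^esub> inv\<^bsub>H\<^esub> sub.cls ts = \<one>\<^bsub>H\<^esub>"
    using assms by (simp add: sub.cls_append sub.cls_rev)
  then show ?thesis using assms sub.inv_equality[of "sub.cls ss" "inv\<^bsub>H\<^esub> sub.cls ts"] by simp
qed

lemma incl_closed [simp]: "a \<in> carrier H \<Longrightarrow> cox_incl \<Gamma> a \<in> carrier G"
  by (erule sub.carrierE) (use T in \<open>auto simp: incl_cls\<close>)

lemma incl_inject:
  assumes "a \<in> carrier H" "b \<in> carrier H"
  shows "cox_incl \<Gamma> a = cox_incl \<Gamma> b \<longleftrightarrow> a = b"
proof -
  obtain ss where "set ss \<subseteq> T" "a = sub.cls ss" using assms(1) by (rule sub_wordE)
  moreover obtain ts where "set ts \<subseteq> T" "b = sub.cls ts" using assms(2) by (rule sub_wordE)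
  ultimately show ?thesis using cls_sub_inject[of ss ts] incl_cls[of ss] incl_cls[of ts] by metis
qed

lemma incl_mult:
  assumes "a \<in> carrier H" "b \<in> carrier H"
  shows "cox_incl \<Gamma> (a \<otimes>\<^bsub>H\<^esub> b) = cox_incl \<Gamma> a \<cdot> cox_incl \<Gamma> b"
proof -
  obtain ss where ss: "set ss \<subseteq> T" "a = sub.cls ss" using assms(1) by (rule sub_wordE)
  obtain ts where ts: "set ts \<subseteq> T" "b = sub.cls ts" using assms(2) by (rule sub_wordE)
  note * = ss ts
  then have "a \<otimes>\<^bsub>H\<^esub> b = sub.cls (ss @ ts)" by (simp add: sub.cls_append)
  then show ?thesis using * T by (simp add: incl_cls cls_append)
qed

lemma incl_one [simp]: "cox_incl \<Gamma> \<one>\<^bsub>H\<^esub> = \<e>"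
  using incl_cls[of "[]"] by simp

lemma incl_inv: "a \<in> carrier H \<Longrightarrow> cox_incl \<Gamma> (inv\<^bsub>H\<^esub> a) = \<iota> (cox_incl \<Gamma> a)"
  by (rule inv_equality[symmetric]) (simp_all flip: incl_mult)

lemma incl_gen: "t \<in> T \<Longrightarrow> cox_incl \<Gamma> (cox_gen (\<Gamma> \<restriction>\<^sub>C T) t) = gen t"
  using incl_cls[of "[t]"] by (simp add: cls_single sub.cls_single)

lemma incl_parabolic:
  assumes "X \<subseteq> T" "a \<in> carrier H"
  shows "cox_incl \<Gamma> a \<in> cox_parabolic \<Gamma> X \<longleftrightarrow> a \<in> cox_parabolic (\<Gamma> \<restriction>\<^sub>C T) X"
proof
  assume "a \<in> cox_parabolic (\<Gamma> \<restriction>\<^sub>C T) X"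
  then obtain ss where "set ss \<subseteq> X" "a = sub.cls ss" using sub.parabolic_iff assms by auto
  then show "cox_incl \<Gamma> a \<in> cox_parabolic \<Gamma> X"
    using incl_cls[of ss] cls_parabolic[of ss X] assms(1) T by auto
next
  assume "cox_incl \<Gamma> a \<in> cox_parabolic \<Gamma> X"
  then obtain ss where ss: "set ss \<subseteq> X" "cox_incl \<Gamma> a = cls ss"
    using parabolic_iff[of X] assms(1) T by auto
  then have "a = sub.cls ss"
    using incl_inject[of a "sub.cls ss"] incl_cls[of ss] assms by auto
  then show "a \<in> cox_parabolic (\<Gamma> \<restriction>\<^sub>C T) X"
    using sub.cls_parabolic[of ss X] ss assms by auto
qed

lemma incl_in_parabolic:
  assumes "a \<in> carrier H" shows "cox_incl \<Gamma> a \<in> cox_parabolic \<Gamma> T"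
proof -
  obtain ss where "set ss \<subseteq> T" "a = sub.cls ss"
    using assms(1) by (rule sub_wordE)
  then show ?thesis using cls_parabolic[of ss T] T by (simp add: incl_cls)
qed

lemma parabolic_inclE:
  assumes "w \<in> cox_parabolic \<Gamma> T"
  obtains a where "a \<in> carrier H" "w = cox_incl \<Gamma> a"
proof -
  obtain ss where "set ss \<subseteq> T" "w = cls ss" using assms parabolic_iff[OF T] by auto
  then show ?thesis using that[of "sub.cls ss"] by (simp add: incl_cls)
qed

text \<open>By injectivity each test of \<open>r\<close> against a generator has the same outcome in
  both groups, so the same reflections are counted.\<close>

lemma par_sub:
  "set ss \<subseteq> T \<Longrightarrow> r \<in> carrier H \<Longrightarrow> sub.par ss r \<longleftrightarrow> par ss (cox_incl \<Gamma> r)"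
proof (induction ss arbitrary: r)
  case (Cons s ss)
  let ?g = "cox_gen (\<Gamma> \<restriction>\<^sub>C T) s"
  have s: "s \<in> T" "?g \<in> carrier H" using Cons by auto
  have "cox_incl \<Gamma> (?g \<otimes>\<^bsub>H\<^esub> r \<otimes>\<^bsub>H\<^esub> ?g) = gen s \<cdot> cox_incl \<Gamma> r \<cdot> gen s"
    using s Cons.prems by (simp add: incl_mult incl_gen)
  moreover have "r = ?g \<longleftrightarrow> cox_incl \<Gamma> r = gen s"
    using incl_inject[of r ?g] s Cons.prems by (simp add: incl_gen)
  ultimately show ?case using Cons s by simp
qed simp

lemma incl_refls:
  assumes "w \<in> carrier H" "r \<in> carrier H"
  shows "cox_incl \<Gamma> r \<in> refls (cox_incl \<Gamma> w) \<longleftrightarrow> r \<in> sub.refls w"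
proof -
  obtain ss where "set ss \<subseteq> T" "w = sub.cls ss"
    using assms(1) by (rule sub_wordE)
  then show ?thesis using assms T by (simp add: incl_cls refls_cls sub.refls_cls par_sub)
qed

end

text \<open>\<open>u = u\<^sub>0 u\<^sub>1\<close> with \<open>u\<^sub>0 \<in> W\<^sub>T\<close> and \<open>u\<^sub>1\<close> of minimal length in \<open>W\<^sub>T u\<close> is sent to \<open>u\<^sub>0\<close>, and \<open>X\<close> to
  \<open>{t \<in> T. t \<in> u\<^sub>1 W\<^sub>X u\<^sub>1\<^sup>-\<^sup>1}\<close>.\<close>

definition parabolic_part :: "'a coxeter_graph \<Rightarrow> 'a set \<Rightarrow> 'a gword set \<Rightarrow> 'a gword set" where
  "parabolic_part \<Gamma> T u = (THE a. a \<in> carrier (cox_group (\<Gamma> \<restriction>\<^sub>C T)) \<and>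
    coxeter.left_reduced \<Gamma> T (inv\<^bsub>cox_group \<Gamma>\<^esub> cox_incl \<Gamma> a \<otimes>\<^bsub>cox_group \<Gamma>\<^esub> u))"

definition omega_proj :: "'a coxeter_graph \<Rightarrow> 'a set \<Rightarrow> 'a omega_vertex \<Rightarrow> 'a omega_vertex" where
  "omega_proj \<Gamma> T = (\<lambda>(u, X). let a = parabolic_part \<Gamma> T u in
    (a, coxeter.conj_part \<Gamma> T (inv\<^bsub>cox_group \<Gamma>\<^esub> cox_incl \<Gamma> a \<otimes>\<^bsub>cox_group \<Gamma>\<^esub> u) X))"

context coxeter_sub begin

text \<open>Makes the definite description computable: any factorisation with left reduced second
  factor is the right one, since two of them differ by an element of W_T that
  \<open>left_reduced_unique\<close> shows to be 1.\<close>

lemma omega_proj_eq: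
  assumes "a \<in> carrier H" "left_reduced T d"
  shows "omega_proj \<Gamma> T (cox_incl \<Gamma> a \<cdot> d, X) = (a, conj_part T d X)"
proof -
  have d: "d \<in> carrier G" using assms by (simp add: left_reduced_def)
  interpret P: subgroup "cox_parabolic \<Gamma> T" G using T by (rule subgroup_parabolic)
  have "parabolic_part \<Gamma> T (cox_incl \<Gamma> a \<cdot> d) = a"
    unfolding parabolic_part_def
  proof (rule the_equality)
    show "a \<in> carrier H \<and> left_reduced T (\<iota> (cox_incl \<Gamma> a) \<cdot> (cox_incl \<Gamma> a \<cdot> d))"
      using assms d by simp
  next
    fix b assume b: "b \<in> carrier H \<and> left_reduced T (\<iota> (cox_incl \<Gamma> b) \<cdot> (cox_incl \<Gamma> a \<cdot> d))"
    let ?c = "\<iota> (cox_incl \<Gamma> b) \<cdot> cox_incl \<Gamma> a"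
    have "?c \<in> cox_parabolic \<Gamma> T" using b assms incl_in_parabolic by blast
    moreover have "left_reduced T (?c \<cdot> d)" using b assms d by (simp add: m_assoc)
    ultimately have "?c = \<e>"
      using left_reduced_unique[OF T _ assms(2), of ?c] gen_parabolic
      unfolding left_reduced_def by blast
    from inv_comm[OF this] have "cox_incl \<Gamma> a \<cdot> \<iota> (cox_incl \<Gamma> b) = \<e>"
      using b assms by simp
    then have "cox_incl \<Gamma> b = cox_incl \<Gamma> a"
      using b assms inv_equality[of "cox_incl \<Gamma> a" "\<iota> (cox_incl \<Gamma> b)"] by simp
    then show "b = a" using incl_inject b assms by blast
  qed
  then show ?thesis using assms d by (simp add: omega_proj_def)
qed

lemma part_decomposition:
  assumes "u \<in> carrier G"
  obtains a d where "a \<in> carrier H" "left_reduced T d" "u = cox_incl \<Gamma> a \<cdot> d"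
proof -
  obtain b where b: "b \<in> cox_parabolic \<Gamma> T" "left_reduced T (\<iota> b \<cdot> u)"
    using left_reduced_exists[OF T assms] by blast
  then obtain a where a: "a \<in> carrier H" "b = cox_incl \<Gamma> a" by (elim parabolic_inclE)
  show ?thesis using that[OF a(1) b(2)] a assms by simp
qed

lemma omega_proj_equivariant:
  assumes "w \<in> carrier H" "u \<in> carrier G"
  shows "omega_proj \<Gamma> T (cox_incl \<Gamma> w \<cdot> u, X) =
    (\<lambda>(a, Z). (w \<otimes>\<^bsub>H\<^esub> a, Z)) (omega_proj \<Gamma> T (u, X))"
proof -
  obtain a d where u: "a \<in> carrier H" "left_reduced T d" "u = cox_incl \<Gamma> a \<cdot> d"
    using assms(2) by (rule part_decomposition)
  then have "cox_incl \<Gamma> w \<cdot> u = cox_incl \<Gamma> (w \<otimes>\<^bsub>H\<^esub> a) \<cdot> d"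
    using assms(1) by (simp add: incl_mult m_assoc left_reduced_def)
  then show ?thesis using u assms(1) omega_proj_eq[of _ d X] by simp
qed

text \<open>The reduced factor is 1, and the generators lying in W_X are exactly those of X.\<close>

lemma omega_proj_incl:
  assumes "a \<in> carrier H" "X \<subseteq> T"
  shows "omega_proj \<Gamma> T (cox_incl \<Gamma> a, X) = (a, X)"
proof -
  have "gen t \<in> cox_parabolic \<Gamma> X \<longleftrightarrow> t \<in> X" if "t \<in> T" for t
    using that assms(2) T gen_in_parabolic[of X t] gen_parabolic[of t X] by auto
  moreover have "\<iota> \<e> \<cdot> gen t \<cdot> \<e> = gen t" if "t \<in> T" for t
    using that T by (simp add: subset_iff)
  ultimately have "conj_part T \<e> X = X"
    using assms(2) by (auto simp: conj_part_def)
  then show ?thesis using omega_proj_eq[OF assms(1) left_reduced_one[OF T], of X] assms(1) by simp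
qed

text \<open>Conjugation by d embeds the new parabolic subgroup into the finite group W_X.\<close>

lemma finite_conj_part:
  assumes "X \<subseteq> S" "finite (cox_parabolic \<Gamma> X)" "d \<in> carrier G"
  shows "finite (cox_parabolic (\<Gamma> \<restriction>\<^sub>C T) (conj_part T d X))"
proof -
  let ?Z = "conj_part T d X"
  let ?f = "\<lambda>a. \<iota> d \<cdot> cox_incl \<Gamma> a \<cdot> d"
  have Z: "?Z \<subseteq> T" by (auto simp: conj_part_def)
  have car: "a \<in> carrier H" if "a \<in> cox_parabolic (\<Gamma> \<restriction>\<^sub>C T) ?Z" for a
    using sub.parabolic_carrier[of ?Z a] that Z by simp
  have "?f ` cox_parabolic (\<Gamma> \<restriction>\<^sub>C T) ?Z \<subseteq> cox_parabolic \<Gamma> X"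
    using conj_partD[OF T assms(1,3)] incl_parabolic[OF Z car] by auto
  moreover have "inj_on ?f (cox_parabolic (\<Gamma> \<restriction>\<^sub>C T) ?Z)"
    using car assms(3) by (auto intro!: inj_onI simp: m_assoc incl_inject)
  ultimately show ?thesis using assms(2) finite_imageD finite_subset by blast
qed

text \<open>By \<open>cox_reduced_iff\<close> minimality is a statement about N, which passes
  between the two groups by \<open>incl_refls\<close>.\<close>

lemma cox_reduced_sub:
  assumes "X \<subseteq> T" "a \<in> carrier H"
    and "\<And>r. r \<in> cox_parabolic \<Gamma> X \<Longrightarrow>
      cox_incl \<Gamma> a \<cdot> r \<cdot> \<iota> (cox_incl \<Gamma> a) \<notin> refls (cox_incl \<Gamma> a)"
  shows "cox_reduced (\<Gamma> \<restriction>\<^sub>C T) {} X a"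
proof -
  have "a \<otimes>\<^bsub>H\<^esub> r \<otimes>\<^bsub>H\<^esub> inv\<^bsub>H\<^esub> a \<notin> sub.refls a" if r: "r \<in> cox_parabolic (\<Gamma> \<restriction>\<^sub>C T) X" for r
  proof -
    have rH: "r \<in> carrier H" using sub.parabolic_carrier[of X r] assms(1) r by simp
    have "cox_incl \<Gamma> (a \<otimes>\<^bsub>H\<^esub> r \<otimes>\<^bsub>H\<^esub> inv\<^bsub>H\<^esub> a) =
        cox_incl \<Gamma> a \<cdot> cox_incl \<Gamma> r \<cdot> \<iota> (cox_incl \<Gamma> a)"
      using assms(2) rH by (simp add: incl_mult incl_inv)
    then show ?thesis
      using assms(3)[of "cox_incl \<Gamma> r"] incl_parabolic[OF assms(1) rH] r
        incl_refls[of a "a \<otimes>\<^bsub>H\<^esub> r \<otimes>\<^bsub>H\<^esub> inv\<^bsub>H\<^esub> a"] assms(2) rH by simp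
  qed
  then show ?thesis using sub.cox_reduced_iff[of X a] assms(1,2) by simp
qed

lemma omega_proj_vertex:
  assumes "x \<in> omega_vertices \<Gamma>" shows "omega_proj \<Gamma> T x \<in> omega_vertices (\<Gamma> \<restriction>\<^sub>C T)"
proof -
  obtain u X where x: "x = (u, X)" "u \<in> carrier G" "X \<subseteq> S" "finite (cox_parabolic \<Gamma> X)"
    using assms by (auto simp: omega_vertices_def spherical_subsets_def)
  obtain a d where u: "a \<in> carrier H" "left_reduced T d" "u = cox_incl \<Gamma> a \<cdot> d"
    using x(2) by (rule part_decomposition)
  then show ?thesis
    using x finite_conj_part[OF x(3,4), of d] omega_proj_eq[OF u(1,2), of X]
    by (auto simp: omega_vertices_def spherical_subsets_def conj_part_def left_reduced_def)
qed

lemma omega_proj_mono: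
  assumes "(x, y) \<in> omega_order \<Gamma>"
  shows "(omega_proj \<Gamma> T x, omega_proj \<Gamma> T y) \<in> omega_order (\<Gamma> \<restriction>\<^sub>C T)"
proof -
  obtain u X v Y where xy: "x = (u, X)" "y = (v, Y)" "(u, X) \<in> omega_vertices \<Gamma>"
    "(v, Y) \<in> omega_vertices \<Gamma>" "X \<subseteq> Y" "\<iota> v \<cdot> u \<in> cox_parabolic \<Gamma> Y"
    "cox_reduced \<Gamma> {} X (\<iota> v \<cdot> u)"
    using assms by (auto simp: omega_order_def)
  then have uv: "u \<in> carrier G" "v \<in> carrier G" "Y \<subseteq> S"
    by (auto simp: omega_vertices_def spherical_subsets_def)
  obtain a e where u: "a \<in> carrier H" "left_reduced T e" "u = cox_incl \<Gamma> a \<cdot> e"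
    using uv(1) by (rule part_decomposition)
  obtain b d where v: "b \<in> carrier H" "left_reduced T d" "v = cox_incl \<Gamma> b \<cdot> d"
    using uv(2) by (rule part_decomposition)
  have ed: "e \<in> carrier G" "d \<in> carrier G" using u v by (auto simp: left_reduced_def)
  let ?c = "inv\<^bsub>H\<^esub> b \<otimes>\<^bsub>H\<^esub> a"
  have c: "?c \<in> carrier H" using u v by simp
  \<comment> \<open>The identity that feeds the comparison inside W, with c = b^-1 a in the role of
    the factor from W_T.\<close>
  have eq: "d \<cdot> (\<iota> v \<cdot> u) = cox_incl \<Gamma> ?c \<cdot> e"
    using u v ed by (simp add: incl_mult incl_inv inv_mult_group m_assoc)
  note P = T uv(3) incl_in_parabolic[OF c] xy(6) v(2) u(2) eq
  have part: "?c \<in> cox_parabolic (\<Gamma> \<restriction>\<^sub>C T) (conj_part T d Y)"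
    using parabolic_part_conj_part[OF P] incl_parabolic[OF _ c]
    by (auto simp: conj_part_def)
  have sub: "conj_part T e X \<subseteq> conj_part T d Y"
    using projection_order(1)[OF T uv(3) xy(5) incl_in_parabolic[OF c] xy(6,7) v(2) u(2) eq] .
  have red: "cox_reduced (\<Gamma> \<restriction>\<^sub>C T) {} (conj_part T e X) ?c"
    using projection_order(2)[OF T uv(3) xy(5) incl_in_parabolic[OF c] xy(6,7) v(2) u(2) eq]
    by (intro cox_reduced_sub c) (auto simp: conj_part_def)
  have "omega_proj \<Gamma> T x = (a, conj_part T e X)" "omega_proj \<Gamma> T y = (b, conj_part T d Y)"
    using u v xy omega_proj_eq by auto
  then show ?thesis
    using part sub red omega_proj_vertex[of x] omega_proj_vertex[of y] xy
    by (simp add: omega_order_def)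
qed

end

section \<open>Compatibility with restriction to R\<close>

lemma cox_incl_incl:
  assumes "coxeter_graph \<Gamma>" "T \<subseteq> verts \<Gamma>" "R \<subseteq> T" "a \<in> carrier (cox_group (\<Gamma> \<restriction>\<^sub>C R))"
  shows "cox_incl \<Gamma> (cox_incl (\<Gamma> \<restriction>\<^sub>C T) a) = cox_incl \<Gamma> a"
proof -
  interpret T: coxeter_sub \<Gamma> T using assms by unfold_locales auto
  interpret R: coxeter_sub \<Gamma> R using assms by unfold_locales auto
  interpret TR: coxeter_sub "\<Gamma> \<restriction>\<^sub>C T" R using assms by unfold_locales auto
  have eq: "(\<Gamma> \<restriction>\<^sub>C T) \<restriction>\<^sub>C R = \<Gamma> \<restriction>\<^sub>C R" using assms(3) by (rule sub_sub)
  obtain ss where ss: "set ss \<subseteq> R" "a = R.sub.cls ss"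
    using assms(4) by (rule R.sub_wordE)
  have "cox_incl (\<Gamma> \<restriction>\<^sub>C T) a = T.sub.cls ss"
    using TR.incl_cls[OF ss(1)] ss(2) unfolding eq by simp
  then show ?thesis using R.incl_cls[OF ss(1)] T.incl_cls[of ss] ss assms(3) by auto
qed

text \<open>A factorisation u = a d made in W_R with respect to R \<inter> T remains valid in W with
  respect to T. By \<open>left_reducedI\<close> only generators t in T need testing, and one in N(d)
  lies in W_R, hence in R.\<close>

lemma omega_proj_restrict:
  assumes \<Gamma>: "coxeter_graph \<Gamma>" and R: "R \<subseteq> verts \<Gamma>" and T: "T \<subseteq> verts \<Gamma>"
    and u: "u \<in> carrier (cox_group (\<Gamma> \<restriction>\<^sub>C R))" and X: "X \<subseteq> R"
  shows "omega_proj \<Gamma> T (cox_incl \<Gamma> u, X) =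
    (\<lambda>(a, Z). (cox_incl (\<Gamma> \<restriction>\<^sub>C T) a, Z)) (omega_proj (\<Gamma> \<restriction>\<^sub>C R) (R \<inter> T) (u, X))"
proof -
  interpret T: coxeter_sub \<Gamma> T using assms by unfold_locales auto
  interpret R: coxeter_sub \<Gamma> R using assms by unfold_locales auto
  have gR: "coxeter_graph (\<Gamma> \<restriction>\<^sub>C R)" and gT: "coxeter_graph (\<Gamma> \<restriction>\<^sub>C T)"
    using coxeter_sub_graph \<Gamma> R T by auto
  interpret RI: coxeter_sub "\<Gamma> \<restriction>\<^sub>C R" "R \<inter> T" using gR by unfold_locales auto
  interpret TI: coxeter_sub "\<Gamma> \<restriction>\<^sub>C T" "R \<inter> T" using gT by unfold_locales auto
  have eqR: "(\<Gamma> \<restriction>\<^sub>C R) \<restriction>\<^sub>C (R \<inter> T) = \<Gamma> \<restriction>\<^sub>C (R \<inter> T)"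
    and eqT: "(\<Gamma> \<restriction>\<^sub>C T) \<restriction>\<^sub>C (R \<inter> T) = \<Gamma> \<restriction>\<^sub>C (R \<inter> T)" by (auto intro: sub_sub)
  obtain a d where ad: "a \<in> carrier RI.H" "R.sub.left_reduced (R \<inter> T) d"
      "u = cox_incl (\<Gamma> \<restriction>\<^sub>C R) a \<otimes>\<^bsub>R.H\<^esub> d"
    using u by (rule RI.part_decomposition)
  have d: "d \<in> carrier R.H" using ad(2) by (simp add: R.sub.left_reduced_def)
  let ?b = "cox_incl (\<Gamma> \<restriction>\<^sub>C T) a" and ?d = "cox_incl \<Gamma> d"
  have b: "?b \<in> carrier T.H" using TI.incl_closed[of a] ad(1) by (simp add: eqR eqT)
  have bu: "cox_incl \<Gamma> u = cox_incl \<Gamma> ?b \<otimes>\<^bsub>T.G\<^esub> ?d"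
  proof -
    have "cox_incl \<Gamma> ?b = cox_incl \<Gamma> (cox_incl (\<Gamma> \<restriction>\<^sub>C R) a)"
      using cox_incl_incl[OF \<Gamma> T, of "R \<inter> T" a] cox_incl_incl[OF \<Gamma> R, of "R \<inter> T" a] ad(1)
      by (simp add: eqR)
    then show ?thesis using ad d RI.incl_closed[of a] by (simp add: R.incl_mult)
  qed
  have red: "T.left_reduced T ?d"
  proof (rule T.left_reducedI[OF T])
    show "?d \<in> carrier T.G" using d by simp
    show "\<forall>t\<in>T. cox_gen \<Gamma> t \<notin> T.refls ?d"
    proof (intro ballI notI)
      fix t assume t: "t \<in> T" "cox_gen \<Gamma> t \<in> T.refls ?d"
      have "cox_gen \<Gamma> t \<in> cox_parabolic \<Gamma> R"
        using T.refls_parabolic[OF R R.incl_in_parabolic[OF d] t(2)] .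
      then have tR: "t \<in> R" using T.gen_in_parabolic[OF R] t T by auto
      then have "cox_gen (\<Gamma> \<restriction>\<^sub>C R) t \<in> R.sub.refls d"
        using R.incl_refls[OF d, of "cox_gen (\<Gamma> \<restriction>\<^sub>C R) t"] t(2) by (simp add: R.incl_gen)
      moreover have "cox_gen (\<Gamma> \<restriction>\<^sub>C R) t \<in> cox_parabolic (\<Gamma> \<restriction>\<^sub>C R) (R \<inter> T)"
        using t tR by (intro R.sub.gen_parabolic) auto
      ultimately show False using ad(2) by (auto simp: R.sub.left_reduced_def)
    qed
  qed
  have part: "T.conj_part T ?d X = R.sub.conj_part (R \<inter> T) d X"
  proof -
    have iff: "inv\<^bsub>T.G\<^esub> ?d \<otimes>\<^bsub>T.G\<^esub> cox_gen \<Gamma> t \<otimes>\<^bsub>T.G\<^esub> ?d \<in> cox_parabolic \<Gamma> X \<longleftrightarrow>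
        inv\<^bsub>R.H\<^esub> d \<otimes>\<^bsub>R.H\<^esub> cox_gen (\<Gamma> \<restriction>\<^sub>C R) t \<otimes>\<^bsub>R.H\<^esub> d \<in> cox_parabolic (\<Gamma> \<restriction>\<^sub>C R) X"
      if "t \<in> R" for t
    proof -
      have g: "cox_gen (\<Gamma> \<restriction>\<^sub>C R) t \<in> carrier R.H" using that by simp
      have "cox_incl \<Gamma> (inv\<^bsub>R.H\<^esub> d \<otimes>\<^bsub>R.H\<^esub> cox_gen (\<Gamma> \<restriction>\<^sub>C R) t \<otimes>\<^bsub>R.H\<^esub> d) =
          inv\<^bsub>T.G\<^esub> ?d \<otimes>\<^bsub>T.G\<^esub> cox_gen \<Gamma> t \<otimes>\<^bsub>T.G\<^esub> ?d"
        using d g that by (simp add: R.incl_mult R.incl_inv R.incl_gen)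
      then show ?thesis
        using R.incl_parabolic[OF X, of "inv\<^bsub>R.H\<^esub> d \<otimes>\<^bsub>R.H\<^esub> cox_gen (\<Gamma> \<restriction>\<^sub>C R) t \<otimes>\<^bsub>R.H\<^esub> d"] d g
        by simp
    qed
    \<comment> \<open>Both d and the conjugate of t by d lie in W_R, hence so does t itself, and
      generators in W_R belong to R.\<close>
    have "t \<in> R" if t: "t \<in> T"
      "inv\<^bsub>T.G\<^esub> ?d \<otimes>\<^bsub>T.G\<^esub> cox_gen \<Gamma> t \<otimes>\<^bsub>T.G\<^esub> ?d \<in> cox_parabolic \<Gamma> X" for t
    proof -
      interpret P: subgroup "cox_parabolic \<Gamma> R" T.G using R by (rule T.subgroup_parabolic)
      let ?x = "inv\<^bsub>T.G\<^esub> ?d \<otimes>\<^bsub>T.G\<^esub> cox_gen \<Gamma> t \<otimes>\<^bsub>T.G\<^esub> ?d"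
      have "?d \<in> cox_parabolic \<Gamma> R" using d by (rule R.incl_in_parabolic)
      moreover have "?x \<in> cox_parabolic \<Gamma> R"
        using t(2) T.parabolic_mono[OF X] by blast
      ultimately have "?d \<otimes>\<^bsub>T.G\<^esub> ?x \<otimes>\<^bsub>T.G\<^esub> inv\<^bsub>T.G\<^esub> ?d \<in> cox_parabolic \<Gamma> R" by blast
      moreover have "?d \<otimes>\<^bsub>T.G\<^esub> ?x \<otimes>\<^bsub>T.G\<^esub> inv\<^bsub>T.G\<^esub> ?d = cox_gen \<Gamma> t"
        using d t T T.gen_closed[of t] by (simp add: T.m_assoc subset_iff)
      ultimately show ?thesis using T.gen_in_parabolic[OF R, of t] t T by auto
    qed
    then show ?thesis unfolding T.conj_part_def R.sub.conj_part_def using iff by blast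
  qed
  have "omega_proj \<Gamma> T (cox_incl \<Gamma> u, X) = (?b, T.conj_part T ?d X)"
    unfolding bu by (rule T.omega_proj_eq[OF b red])
  moreover have "omega_proj (\<Gamma> \<restriction>\<^sub>C R) (R \<inter> T) (u, X) = (a, R.sub.conj_part (R \<inter> T) d X)"
    unfolding ad(3) by (rule RI.omega_proj_eq[OF ad(1,2)])
  ultimately show ?thesis by (simp add: part)
qed


section \<open>Simplicial maps\<close>

lemma realization_map_cong:
  assumes "\<And>x. \<alpha> x \<noteq> 0 \<Longrightarrow> f x = g x"
  shows "realization_map f \<alpha> = realization_map g \<alpha>"
  using assms unfolding realization_map_def by (intro ext sum.cong) auto

lemma realization_map_ident:
  assumes "\<And>x. \<alpha> x \<noteq> 0 \<Longrightarrow> f x = x"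
  shows "realization_map f \<alpha> = \<alpha>"
proof
  fix y
  have "{x. \<alpha> x \<noteq> 0 \<and> f x = y} = (if \<alpha> y \<noteq> 0 then {y} else {})" using assms by auto
  then show "realization_map f \<alpha> y = \<alpha> y" by (simp add: realization_map_def)
qed

text \<open>Nonnegative coordinates cannot cancel, so the support of the image is the image of the
  support. Functoriality in \<open>realization_map_comp\<close> depends on this.\<close>

lemma realization_map_nonzero_iff:
  assumes "finite {x. \<alpha> x \<noteq> 0}" "\<And>x. \<alpha> x \<ge> 0"
  shows "realization_map f \<alpha> y \<noteq> 0 \<longleftrightarrow> (\<exists>x. \<alpha> x \<noteq> 0 \<and> f x = y)"
proof -
  have "finite {x. \<alpha> x \<noteq> 0 \<and> f x = y}" using assms(1) by (rule rev_finite_subset) auto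
  then show ?thesis
    unfolding realization_map_def using assms(2) by (subst sum_nonneg_eq_0_iff) auto
qed

lemma realization_map_comp:
  assumes "finite {x. \<alpha> x \<noteq> 0}" "\<And>x. \<alpha> x \<ge> 0"
  shows "realization_map f (realization_map g \<alpha>) = realization_map (f \<circ> g) \<alpha>"
proof
  fix z
  let ?A = "{x. \<alpha> x \<noteq> 0 \<and> f (g x) = z}"
  let ?B = "{y. realization_map g \<alpha> y \<noteq> 0 \<and> f y = z}"
  have B: "?B = g ` ?A" unfolding realization_map_nonzero_iff[OF assms] by auto
  have A: "finite ?A" using assms(1) by (rule rev_finite_subset) auto
  have "realization_map f (realization_map g \<alpha>) z = (\<Sum>y\<in>?B. realization_map g \<alpha> y)"
    by (simp add: realization_map_def)
  also have "\<dots> = (\<Sum>y\<in>?B. \<Sum>x | x \<in> ?A \<and> g x = y. \<alpha> x)"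
    by (rule sum.cong[OF HOL.refl], subst realization_map_def, rule sum.cong) auto
  also have "\<dots> = (\<Sum>x\<in>?A. \<alpha> x)"
    using A B by (intro sum.group) auto
  finally show "realization_map f (realization_map g \<alpha>) z = realization_map (f \<circ> g) \<alpha> z"
    by (simp add: realization_map_def)
qed

section \<open>Continuity of simplicial maps in the weak topology\<close>

definition simplicial_complex :: "'v set set \<Rightarrow> bool" where
  "simplicial_complex K \<longleftrightarrow>
    (\<forall>\<sigma>\<in>K. finite \<sigma> \<and> \<sigma> \<noteq> {} \<and> (\<forall>\<tau>. \<tau> \<subseteq> \<sigma> \<longrightarrow> \<tau> \<noteq> {} \<longrightarrow> \<tau> \<in> K))"

lemma closed_simplex_points:
  assumes "simplicial_complex K" "\<sigma> \<in> K"
  shows "closed_simplex \<sigma> \<subseteq> realization_points K"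
proof
  fix \<alpha> assume a: "\<alpha> \<in> closed_simplex \<sigma>"
  have fin: "finite \<sigma>" using assms by (auto simp: simplicial_complex_def)
  have s: "{v. \<alpha> v \<noteq> 0} \<subseteq> \<sigma>" "\<forall>v. \<alpha> v \<ge> 0" "(\<Sum>v\<in>\<sigma>. \<alpha> v) = 1"
    using a by (simp_all add: closed_simplex_def)
  have "(\<Sum>v\<in>\<sigma>. \<alpha> v) = (\<Sum>v | \<alpha> v \<noteq> 0. \<alpha> v)"
    using fin s(1) by (intro sum.mono_neutral_right) auto
  then have 1: "(\<Sum>v | \<alpha> v \<noteq> 0. \<alpha> v) = 1" using s by simp
  then have "{v. \<alpha> v \<noteq> 0} \<noteq> {}" by (intro notI) simp
  then have "{v. \<alpha> v \<noteq> 0} \<in> K" using assms s(1) by (simp add: simplicial_complex_def)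
  then show "\<alpha> \<in> realization_points K" using s 1 by (simp add: realization_points_def)
qed

lemma topspace_geometric_realization:
  assumes "simplicial_complex K"
  shows "topspace (geometric_realization K) = realization_points K"
proof
  show "topspace (geometric_realization K) \<subseteq> realization_points K"
    using openin_topspace[of "geometric_realization K"]
    unfolding openin_geometric_realization by (rule conjunct1)
  have "openin (geometric_realization K) (realization_points K)"
    unfolding openin_geometric_realization
    using closed_simplex_points[OF assms] by (simp add: Int_absorb1)
  then show "realization_points K \<subseteq> topspace (geometric_realization K)"
    by (rule openin_subset)
qed

text \<open>On a closed simplex the sum over the varying support becomes a sum over a fixed finite
  set, which makes the map visibly continuous there.\<close>

lemma realization_map_simplex:
  assumes "finite \<sigma>" "\<alpha> \<in> closed_simplex \<sigma>"
  shows "realization_map f \<alpha> y = (\<Sum>x | x \<in> \<sigma> \<and> f x = y. \<alpha> x)"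
    and "realization_map f \<alpha> \<in> closed_simplex (f ` \<sigma>)"
proof -
  have s: "{v. \<alpha> v \<noteq> 0} \<subseteq> \<sigma>" "\<forall>v. \<alpha> v \<ge> 0" "(\<Sum>v\<in>\<sigma>. \<alpha> v) = 1"
    using assms by (simp_all add: closed_simplex_def)
  show eq: "realization_map f \<alpha> y = (\<Sum>x | x \<in> \<sigma> \<and> f x = y. \<alpha> x)" for y
    unfolding realization_map_def using assms(1) s by (intro sum.mono_neutral_left) auto
  have "(\<Sum>y\<in>f ` \<sigma>. realization_map f \<alpha> y) = (\<Sum>v\<in>\<sigma>. \<alpha> v)"
    unfolding eq using assms(1) by (intro sum.group) auto
  moreover have "realization_map f \<alpha> y \<ge> 0" for y
    unfolding eq using s by (intro sum_nonneg) auto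
  moreover have "realization_map f \<alpha> y = 0" if "y \<notin> f ` \<sigma>" for y
    unfolding eq using that by (intro sum.neutral) auto
  ultimately show "realization_map f \<alpha> \<in> closed_simplex (f ` \<sigma>)"
    using s by (auto simp: closed_simplex_def)
qed

lemma continuous_map_realization_map:
  assumes K: "simplicial_complex K" and K': "simplicial_complex K'"
    and f: "\<And>\<sigma>. \<sigma> \<in> K \<Longrightarrow> f ` \<sigma> \<in> K'"
  shows "continuous_map (geometric_realization K) (geometric_realization K') (realization_map f)"
  unfolding continuous_map_def topspace_geometric_realization[OF K] topspace_geometric_realization[OF K']
proof (intro conjI funcsetI allI impI)
  fix \<alpha> assume a: "\<alpha> \<in> realization_points K"
  let ?\<sigma> = "{v. \<alpha> v \<noteq> 0}"
  have \<sigma>: "?\<sigma> \<in> K" "\<alpha> \<in> closed_simplex ?\<sigma>"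
    using a by (auto simp: realization_points_def closed_simplex_def)
  then have "finite ?\<sigma>" using K by (auto simp: simplicial_complex_def)
  then show "realization_map f \<alpha> \<in> realization_points K'"
    using realization_map_simplex(2)[of ?\<sigma> \<alpha> f] \<sigma> closed_simplex_points[OF K' f[OF \<sigma>(1)]] by blast
next
  fix U assume U: "openin (geometric_realization K') U"
  let ?V = "{\<alpha> \<in> realization_points K. realization_map f \<alpha> \<in> U}"
  have "openin (top_of_set (closed_simplex \<sigma>)) (?V \<inter> closed_simplex \<sigma>)" if \<sigma>: "\<sigma> \<in> K" for \<sigma>
  proof -
    have fin: "finite \<sigma>" using K \<sigma> by (auto simp: simplicial_complex_def)
    \<comment> \<open>\<open>top_of_set\<close> uses the product topology on functions, so
      continuity is checked one coordinate at a time.\<close>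
    have "continuous_on (closed_simplex \<sigma>) (\<lambda>\<alpha>. \<alpha> x)" for x
      by (rule continuous_on_product_then_coordinatewise[OF continuous_on_id])
    then have "continuous_on (closed_simplex \<sigma>) (\<lambda>\<alpha> y. \<Sum>x | x \<in> \<sigma> \<and> f x = y. \<alpha> x)"
      by (intro continuous_on_coordinatewise_then_product continuous_on_sum)
    then have cont: "continuous_on (closed_simplex \<sigma>) (realization_map f)"
      by (rule continuous_on_eq) (simp add: realization_map_simplex(1)[OF fin] fun_eq_iff)
    have "openin (top_of_set (closed_simplex (f ` \<sigma>))) (U \<inter> closed_simplex (f ` \<sigma>))"
      using U f[OF \<sigma>] by (simp add: openin_geometric_realization)
    then have "openin (top_of_set (closed_simplex \<sigma>))
        (closed_simplex \<sigma> \<inter> realization_map f -` (U \<inter> closed_simplex (f ` \<sigma>)))"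
      using realization_map_simplex(2)[OF fin] by (intro continuous_openin_preimage[OF cont]) auto
    moreover have "closed_simplex \<sigma> \<inter> realization_map f -` (U \<inter> closed_simplex (f ` \<sigma>)) =
        ?V \<inter> closed_simplex \<sigma>"
      using closed_simplex_points[OF K \<sigma>] realization_map_simplex(2)[OF fin] by auto
    ultimately show ?thesis by simp
  qed
  then show "openin (geometric_realization K) ?V"
    by (auto simp: openin_geometric_realization)
qed

lemma simplicial_complex_order_complex: "simplicial_complex (order_complex r)"
  unfolding simplicial_complex_def order_complex_def
  by (auto simp: Chains_def intro: finite_subset)

lemma order_complex_image:
  assumes "\<And>x y. (x, y) \<in> r \<Longrightarrow> (f x, f y) \<in> r'" "\<sigma> \<in> order_complex r"
  shows "f ` \<sigma> \<in> order_complex r'"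
  using assms unfolding order_complex_def Chains_def by blast


section \<open>The retractions\<close>

lemma omega_pointD:
  assumes "x \<in> topspace (omega \<Gamma>)"
  shows "finite {p. x p \<noteq> 0}" "x p \<ge> 0" "x p \<noteq> 0 \<Longrightarrow> p \<in> omega_vertices \<Gamma>"
proof -
  have x: "{p. x p \<noteq> 0} \<in> order_complex (omega_order \<Gamma>)" "x p \<ge> 0"
    using assms
    by (auto simp: omega_def topspace_geometric_realization simplicial_complex_order_complex
        realization_points_def simp del: split_paired_All)
  then show "finite {p. x p \<noteq> 0}" "x p \<ge> 0" by (auto simp: order_complex_def)
  assume "x p \<noteq> 0"
  \<comment> \<open>Membership in \<open>Chains\<close> compares each element with itself too, so
    every vertex of a chain lies in the field of the order.\<close>
  then have "(p, p) \<in> omega_order \<Gamma>"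
    using x(1) unfolding order_complex_def Chains_def by blast
  then show "p \<in> omega_vertices \<Gamma>" by (auto simp: omega_order_def)
qed

text \<open>A single family is chosen for all graphs at once, because (2) relates its values at two
  graphs. The equation in (2) lives in Omega(Gamma_T), hence the embedding on its right-hand side.
  Apart from continuity, each claim reduces to an identity between vertex maps on the support of the
  point.\<close>

theorem theorem2p2:
  shows "\<exists>\<pi> :: 'a coxeter_graph \<Rightarrow> 'a set \<Rightarrow> 'a omega_point \<Rightarrow> 'a omega_point.
    \<forall>\<Gamma>. coxeter_graph \<Gamma> \<longrightarrow>
      (\<forall>T. T \<subseteq> verts \<Gamma> \<longrightarrow>
        continuous_map (omega \<Gamma>) (omega (\<Gamma> \<restriction>\<^sub>C T)) (\<pi> \<Gamma> T) \<and>
        (\<forall>x \<in> topspace (omega (\<Gamma> \<restriction>\<^sub>C T)). \<pi> \<Gamma> T (omega_incl \<Gamma> x) = x) \<and>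
        (\<forall>w \<in> carrier (cox_group (\<Gamma> \<restriction>\<^sub>C T)). \<forall>x \<in> topspace (omega \<Gamma>).
          \<pi> \<Gamma> T (omega_act \<Gamma> (cox_incl \<Gamma> w) x) = omega_act (\<Gamma> \<restriction>\<^sub>C T) w (\<pi> \<Gamma> T x))) \<and>
      (\<forall>R T. R \<subseteq> verts \<Gamma> \<and> T \<subseteq> verts \<Gamma> \<longrightarrow>
        (\<forall>x \<in> topspace (omega (\<Gamma> \<restriction>\<^sub>C R)).
          \<pi> \<Gamma> T (omega_incl \<Gamma> x) =
            omega_incl (\<Gamma> \<restriction>\<^sub>C T) (\<pi> (\<Gamma> \<restriction>\<^sub>C R) (R \<inter> T) x)))"
proof (intro exI[of _ "\<lambda>\<Gamma> T. realization_map (omega_proj \<Gamma> T)"] allI impI conjI ballI)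
  fix \<Gamma> :: "'a coxeter_graph" and T
  assume "coxeter_graph \<Gamma>" "T \<subseteq> verts \<Gamma>"
  then interpret coxeter_sub \<Gamma> T by unfold_locales
  show "continuous_map (omega \<Gamma>) (omega (\<Gamma> \<restriction>\<^sub>C T)) (realization_map (omega_proj \<Gamma> T))"
    unfolding omega_def
    by (intro continuous_map_realization_map simplicial_complex_order_complex
        order_complex_image[OF omega_proj_mono])
next
  fix \<Gamma> :: "'a coxeter_graph" and T x
  assume "coxeter_graph \<Gamma>" "T \<subseteq> verts \<Gamma>" and x: "x \<in> topspace (omega (\<Gamma> \<restriction>\<^sub>C T))"
  then interpret coxeter_sub \<Gamma> T by unfold_locales
  have "omega_proj \<Gamma> T ((\<lambda>(u, X). (cox_incl \<Gamma> u, X)) p) = p" if "x p \<noteq> 0" for p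
    using omega_pointD(3)[OF x that] omega_proj_incl
    by (auto simp: omega_vertices_def spherical_subsets_def)
  then show "realization_map (omega_proj \<Gamma> T) (omega_incl \<Gamma> x) = x"
    unfolding omega_incl_def realization_map_comp[OF omega_pointD(1,2)[OF x]]
    by (intro realization_map_ident) simp
next
  fix \<Gamma> :: "'a coxeter_graph" and T w x
  assume "coxeter_graph \<Gamma>" "T \<subseteq> verts \<Gamma>" and w: "w \<in> carrier (cox_group (\<Gamma> \<restriction>\<^sub>C T))"
    and x: "x \<in> topspace (omega \<Gamma>)"
  then interpret coxeter_sub \<Gamma> T by unfold_locales
  have "omega_proj \<Gamma> T ((\<lambda>(u, X). (cox_incl \<Gamma> w \<otimes>\<^bsub>cox_group \<Gamma>\<^esub> u, X)) p) =
      (\<lambda>(u, X). (w \<otimes>\<^bsub>H\<^esub> u, X)) (omega_proj \<Gamma> T p)" if "x p \<noteq> 0" for p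
    using omega_pointD(3)[OF x that] omega_proj_equivariant[OF w]
    by (auto simp: omega_vertices_def)
  then show "realization_map (omega_proj \<Gamma> T) (omega_act \<Gamma> (cox_incl \<Gamma> w) x) =
      omega_act (\<Gamma> \<restriction>\<^sub>C T) w (realization_map (omega_proj \<Gamma> T) x)"
    unfolding omega_act_def realization_map_comp[OF omega_pointD(1,2)[OF x]]
    by (intro realization_map_cong) simp
next
  fix \<Gamma> :: "'a coxeter_graph" and R T x
  assume \<Gamma>: "coxeter_graph \<Gamma>" and RT: "R \<subseteq> verts \<Gamma> \<and> T \<subseteq> verts \<Gamma>"
    and x: "x \<in> topspace (omega (\<Gamma> \<restriction>\<^sub>C R))"
  have "omega_proj \<Gamma> T ((\<lambda>(u, X). (cox_incl \<Gamma> u, X)) p) =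
      (\<lambda>(u, X). (cox_incl (\<Gamma> \<restriction>\<^sub>C T) u, X)) (omega_proj (\<Gamma> \<restriction>\<^sub>C R) (R \<inter> T) p)" if "x p \<noteq> 0" for p
    using omega_pointD(3)[OF x that] omega_proj_restrict[OF \<Gamma>, of R T] RT
    by (auto simp: omega_vertices_def spherical_subsets_def)
  then show "realization_map (omega_proj \<Gamma> T) (omega_incl \<Gamma> x) =
      omega_incl (\<Gamma> \<restriction>\<^sub>C T) (realization_map (omega_proj (\<Gamma> \<restriction>\<^sub>C R) (R \<inter> T)) x)"
    unfolding omega_incl_def realization_map_comp[OF omega_pointD(1,2)[OF x]]
    by (intro realization_map_cong) simp
qed

end
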